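(* Let $V$ be the Voronoi tessellation of a closed hyperbolic surface $F$ determined by $\mathcal S \subset F$ finite, and let $P^{(1)}_c$ be the centered dual graph to $V^{(1)}$. For each component $U$ of $F-P^{(1)}_c$, with closure $\overline{U}$, $$\overline{U} = \bigcup_{v\in \overline{U}\cap V^{(0)}} P_v .$$
   Context: For $\widetilde{\mathcal S}\subset\mathbb{H}^2$ closed and discrete and $x\in\widetilde{\mathcal S}$, let $V_x=\{p\in\mathbb{H}^2 : d(p,x)\le d(p,y)\ \text{for all } y\in\widetilde{\mathcal S}-\{x\}\}$. The Voronoi tessellation $\widetilde V$ has $2$-cells the $V_x$, edges the nondegenerate intersections $V_x\cap V_y$ ($x\neq y$), and vertices the points $V_x\cap V_y\cap V_z$ ($x,y,z$ distinct). The geometric dual to an edge $e=V_x\cap V_y$ is the geodesic arc $\gamma_{xy}$ joining $x$ to $y$. For a vertex $\tilde v$ of $\widetilde V$, the vertex polygon (Delaunay $2$-cell) $P_{\tilde v}$ is the compact convex polygon with vertex set $\{x\in\widetilde{\mathcal S}:\tilde v\in V_x\}$; its vertices are all equidistant from $\tilde v$ and its edges are the geometric duals to the edges of $\widetilde V$ containing $\tilde v$. An edge $e=V_x\cap V_y$ is centered if $e$ intersects $\gamma_{xy}$ at a point in the interior of $e$. For a closed hyperbolic surface $F$ with locally isometric universal cover $\pi:\mathbb{H}^2\to F$ and $\mathcal S\subset F$ finite, set $\widetilde{\mathcal S}=\pi^{-1}(\mathcal S)$; the Voronoi tessellation of $F$ is $V=\pi(\widetilde V)$, with vertex set $V^{(0)}$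 and one-skeleton $V^{(1)}$, and for $v\in V^{(0)}$, $P_v=\pi(P_{\tilde v})$ for any $\tilde v\in\pi^{-1}(v)$. An edge of $V$ is centered iff its lifts are; its geometric dual is the image of the geometric dual to a lift. The centered dual graph $P^{(1)}_c$ is the union of the geometric duals to the centered edges of $V$. *)

theory Defs
  imports "HOL-Analysis.Analysis"
begin

section \<open>The hyperbolic plane\<close>

text \<open>
  The Klein (projective) model: the open unit disc with distance
  cosh d(x,y) = (1 - x \<bullet> y) / sqrt ((1 - |x|^2) (1 - |y|^2)).  The topology induced by
  this distance is the Euclidean topology of the disc, so the topological notions of the library
  apply to it as they stand.
\<close>

definition hplane :: "complex set" where
  "hplane = ball 0 1"

definition hdist :: "complex \<Rightarrow> complex \<Rightarrow> real" where
  "hdist x y = arcosh ((1 - x \<bullet> y) / sqrt ((1 - (norm x)\<^sup>2) * (1 - (norm y)\<^sup>2)))"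

definition hball :: "complex \<Rightarrow> real \<Rightarrow> complex set" where
  "hball x r = {y \<in> hplane. hdist x y < r}"

definition geodesic_path ::
    "('p \<Rightarrow> 'p \<Rightarrow> real) \<Rightarrow> 'p set \<Rightarrow> (real \<Rightarrow> 'p) \<Rightarrow> 'p \<Rightarrow> 'p \<Rightarrow> bool" where
  "geodesic_path d X c x y \<longleftrightarrow>
     c ` {0..d x y} \<subseteq> X \<and> c 0 = x \<and> c (d x y) = y \<and>
     (\<forall>s\<in>{0..d x y}. \<forall>t\<in>{0..d x y}. d (c s) (c t) = \<bar>s - t\<bar>)"

text \<open>Geodesic arcs in the hyperbolic plane are unique, so the union below has a single member.\<close>

definition geodesic_arc :: "complex \<Rightarrow> complex \<Rightarrow> complex set" where
  "geodesic_arc x y = \<Union> {c ` {0..hdist x y} | c. geodesic_path hdist hplane c x y}"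

definition hconvex :: "complex set \<Rightarrow> bool" where
  "hconvex C \<longleftrightarrow> C \<subseteq> hplane \<and> (\<forall>x\<in>C. \<forall>y\<in>C. geodesic_arc x y \<subseteq> C)"

text \<open>
  For a geodesic arc (or ray, or line) the interior as a 1-manifold: the points lying strictly
  between two of its points.
\<close>

definition arc_interior :: "complex set \<Rightarrow> complex set" where
  "arc_interior e = {p. \<exists>a\<in>e. \<exists>b\<in>e. p \<in> geodesic_arc a b \<and> p \<noteq> a \<and> p \<noteq> b}"

section \<open>Voronoi tessellation and geometric dual in the hyperbolic plane\<close>

definition voronoi_cell :: "complex set \<Rightarrow> complex \<Rightarrow> complex set" where
  "voronoi_cell T x = {p \<in> hplane. \<forall>y \<in> T - {x}. hdist p x \<le> hdist p y}"

text \<open>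
  An edge is represented by the pair of sites whose cells meet in it.  Nondegenerate means
  consisting of more than one point.
\<close>

definition voronoi_edge :: "complex set \<Rightarrow> complex \<Rightarrow> complex \<Rightarrow> bool" where
  "voronoi_edge T x y \<longleftrightarrow> x \<in> T \<and> y \<in> T \<and> x \<noteq> y \<and>
     (\<exists>p q. p \<noteq> q \<and> {p, q} \<subseteq> voronoi_cell T x \<inter> voronoi_cell T y)"

definition centered_edge :: "complex set \<Rightarrow> complex \<Rightarrow> complex \<Rightarrow> bool" where
  "centered_edge T x y \<longleftrightarrow> voronoi_edge T x y \<and>
     (let e = voronoi_cell T x \<inter> voronoi_cell T y
      in \<exists>p \<in> e \<inter> geodesic_arc x y. p \<in> arc_interior e)"

definition voronoi_vertices :: "complex set \<Rightarrow> complex set" where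
  "voronoi_vertices T = {p. \<exists>x\<in>T. \<exists>y\<in>T. \<exists>z\<in>T. x \<noteq> y \<and> y \<noteq> z \<and> x \<noteq> z \<and>
     p \<in> voronoi_cell T x \<inter> voronoi_cell T y \<inter> voronoi_cell T z}"

definition vertex_polygon :: "complex set \<Rightarrow> complex \<Rightarrow> complex set" where
  "vertex_polygon T v = hconvex hull {x \<in> T. v \<in> voronoi_cell T x}"

section \<open>Closed hyperbolic surfaces\<close>

text \<open>
  A closed hyperbolic surface with its Riemannian distance is a compact connected geodesic
  metric space that is locally isometric to the hyperbolic plane.
\<close>

definition closed_hyperbolic_surface :: "'a::metric_space set \<Rightarrow> bool" where
  "closed_hyperbolic_surface F \<longleftrightarrow> F \<noteq> {} \<and> compact F \<and> connected F \<and>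
     (\<forall>p\<in>F. \<forall>q\<in>F. \<exists>c. geodesic_path dist F c p q) \<and>
     (\<forall>p\<in>F. \<exists>r>0. \<exists>x\<in>hplane. \<exists>f. f ` (F \<inter> ball p r) = hball x r \<and>
        (\<forall>a \<in> F \<inter> ball p r. \<forall>b \<in> F \<inter> ball p r. hdist (f a) (f b) = dist a b))"

text \<open>Universality is automatic, the hyperbolic plane being simply connected.\<close>

definition locally_isometric_universal_cover ::
    "(complex \<Rightarrow> 'a::metric_space) \<Rightarrow> 'a set \<Rightarrow> bool" where
  "locally_isometric_universal_cover \<pi> F \<longleftrightarrow> covering_space hplane \<pi> F \<and>
     (\<forall>x\<in>hplane. \<exists>r>0. \<forall>a \<in> hball x r. \<forall>b \<in> hball x r. dist (\<pi> a) (\<pi> b) = hdist a b)"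

definition lifts :: "(complex \<Rightarrow> 'a) \<Rightarrow> 'a set \<Rightarrow> complex set" where
  "lifts \<pi> S = {x \<in> hplane. \<pi> x \<in> S}"

definition surface_voronoi_vertices :: "(complex \<Rightarrow> 'a) \<Rightarrow> 'a set \<Rightarrow> 'a set" where
  "surface_voronoi_vertices \<pi> S = \<pi> ` voronoi_vertices (lifts \<pi> S)"

text \<open>
  The polygons at the different lifts of \<open>v\<close> are translates of one another by covering
  transformations and have the same image, so the union is the image of any one of them.
\<close>

definition surface_vertex_polygon :: "(complex \<Rightarrow> 'a) \<Rightarrow> 'a set \<Rightarrow> 'a \<Rightarrow> 'a set" where
  "surface_vertex_polygon \<pi> S v = (\<Union>w \<in> lifts \<pi> {v}. \<pi> ` vertex_polygon (lifts \<pi> S) w)"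

definition centered_dual_graph :: "(complex \<Rightarrow> 'a) \<Rightarrow> 'a set \<Rightarrow> 'a set" where
  "centered_dual_graph \<pi> S = \<Union> {\<pi> ` geodesic_arc x y | x y. centered_edge (lifts \<pi> S) x y}"

end

theory Submission
  imports Defs
begin

text \<open>
  Let \<open>v\<close> be a vertex of the Voronoi tessellation of the plane and \<open>p\<close> a point of its polygon.  The
  spoke \<open>[v, p]\<close> meets no geometric dual of a centered edge, except possibly at \<open>p\<close>: the disc with
  diameter such a dual \<open>[x, y]\<close> contains no third site, whereas a dual separating \<open>v\<close> from \<open>p\<close> would
  force a vertex of the polygon into it.  Hence a component \<open>U\<close> of the complement of the centered dual
  graph contains \<open>v\<close> if and only if its closure contains \<open>v\<close>, in which case the closure contains
  the polygon of \<open>v\<close>.  Conversely the polygons cover the plane, so each point of \<open>U\<close> lies in the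
  polygon of some vertex, which the spoke places in \<open>U\<close>; local finiteness extends this to the closure.
\<close>

section \<open>The hyperbolic distance in the Klein model\<close>

text \<open>Geodesics of the Klein disc are chords, so hyperbolic convex hulls are Euclidean ones,
  and comparing the distances from a point to two sites amounts to comparing two affine functions.
  The obstacle is that a polygon need not contain its own vertex: a spoke may leave the polygon and
  cross others, so it cannot be controlled polygon by polygon. The argument therefore speaks of
  sites and empty discs only. That the polygons cover the plane comes from an optimisation over a
  compact set rather than from the combinatorics of the tessellation. The surface enters through a
  covering map that is isometric on small balls. Lifting geodesics bounds the distance from any
  point of the plane to the nearest site by the diameter of \<open>F\<close>; lifting \<pi> through
  itself yields isometries that carry any lift of a point to any other.\<close>

definition gap :: "complex \<Rightarrow> real" where
  "gap x = sqrt (1 - (norm x)\<^sup>2)"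

lemma hplane_iff: "x \<in> hplane \<longleftrightarrow> norm x < 1"
  by (simp add: hplane_def)

lemma convex_hplane: "convex hplane"
  by (simp add: hplane_def)

lemma open_hplane: "open hplane"
  by (simp add: hplane_def)

lemma gap_sq: "x \<in> hplane \<Longrightarrow> (gap x)\<^sup>2 = 1 - x \<bullet> x"
  unfolding gap_def hplane_iff by (simp add: abs_square_le_1 flip: power2_norm_eq_inner)

lemma gap_pos: "x \<in> hplane \<Longrightarrow> gap x > 0"
  unfolding gap_def hplane_iff by (simp add: abs_square_less_1)

lemma inner_hplane_less_1:
  assumes "x \<in> hplane" "norm y \<le> 1"
  shows "x \<bullet> y < 1"
proof -
  have "x \<bullet> y \<le> norm x * norm y" by (rule norm_cauchy_schwarz)
  also have "\<dots> \<le> norm x * 1" using assms by (intro mult_left_mono) auto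
  also have "\<dots> < 1" using assms by (simp add: hplane_iff)
  finally show ?thesis .
qed

text \<open>
  The polarisation of \<open>u \<mapsto> (1 - |y|\<^sup>2) |u|\<^sup>2 + (y \<bullet> u)\<^sup>2\<close>, i.e. of the metric tensor at \<open>y\<close>
  up to the factor \<open>(1 - |y|\<^sup>2)\<^sup>2\<close>.
\<close>

definition tens :: "complex \<Rightarrow> complex \<Rightarrow> complex \<Rightarrow> real" where
  "tens y u w = (gap y)\<^sup>2 * (u \<bullet> w) + (y \<bullet> u) * (y \<bullet> w)"

lemma tens_scaleR: "tens y (a *\<^sub>R u) (b *\<^sub>R w) = a * b * tens y u w"
  by (simp add: tens_def algebra_simps)

lemma tens_pos: "y \<in> hplane \<Longrightarrow> u \<noteq> 0 \<Longrightarrow> tens y u u > 0"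
  using gap_pos[of y] unfolding tens_def
  by (intro add_pos_nonneg mult_pos_pos) auto

lemma tens_nonneg: "tens y u u \<ge> 0"
  unfolding tens_def by (intro add_nonneg_nonneg) auto

lemma tens_Cauchy_Schwarz: "(tens y u w)\<^sup>2 \<le> tens y u u * tens y w w"
  using Cauchy_Schwarz_ineq[of "(gap y *\<^sub>R u, y \<bullet> u)" "(gap y *\<^sub>R w, y \<bullet> w)"]
  by (simp add: tens_def power2_eq_square algebra_simps)

lemma tens_diff:
  assumes "y \<in> hplane"
  shows "tens y (x - y) (z - y) = (1 - x \<bullet> y) * (1 - y \<bullet> z) - (1 - x \<bullet> z) * (gap y)\<^sup>2"
  unfolding tens_def gap_sq[OF assms]
  by (simp add: algebra_simps inner_commute)

text \<open>With (1, x) / \<open>gap x\<close> as the lift of \<open>x\<close> to the hyperboloid,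
  this is the Lorentz product (time minus space) of two lifts.\<close>

definition hcosh :: "complex \<Rightarrow> complex \<Rightarrow> real" where
  "hcosh x y = (1 - x \<bullet> y) / (gap x * gap y)"

lemma hcosh_commute: "hcosh x y = hcosh y x"
  by (simp add: hcosh_def inner_commute mult.commute)

lemma hcosh_pos: "x \<in> hplane \<Longrightarrow> y \<in> hplane \<Longrightarrow> hcosh x y > 0"
  unfolding hcosh_def using inner_hplane_less_1[of x y] gap_pos[of x] gap_pos[of y]
  by (simp add: hplane_iff)

lemma hcosh_sq:
  assumes "x \<in> hplane" "y \<in> hplane"
  shows "(hcosh x y)\<^sup>2 = 1 + tens y (x - y) (x - y) / ((gap x)\<^sup>2 * (gap y)\<^sup>2)"
proof -
  have "tens y (x - y) (x - y) = (1 - x \<bullet> y)\<^sup>2 - (gap x)\<^sup>2 * (gap y)\<^sup>2"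
    unfolding tens_diff[OF assms(2)] gap_sq[OF assms(1)] by (simp add: power2_eq_square inner_commute)
  moreover have "(a / (p * q))\<^sup>2 = 1 + (a\<^sup>2 - p\<^sup>2 * q\<^sup>2) / (p\<^sup>2 * q\<^sup>2)"
    if "p > 0" "q > 0" for a p q :: real
    using that by (simp add: power_divide power_mult_distrib diff_divide_distrib)
  ultimately show ?thesis
    using gap_pos[OF assms(1)] gap_pos[OF assms(2)] by (simp only: hcosh_def)
qed

lemma hcosh_ge_1:
  assumes "x \<in> hplane" "y \<in> hplane"
  shows "hcosh x y \<ge> 1"
proof -
  have "(hcosh x y)\<^sup>2 \<ge> 1\<^sup>2"
    unfolding hcosh_sq[OF assms] using tens_nonneg[of y "x - y"] by simp
  then show ?thesis
    using hcosh_pos[OF assms] by (intro power2_le_imp_le[of 1]) auto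
qed

lemma hcosh_eq_1_iff:
  assumes "x \<in> hplane" "y \<in> hplane"
  shows "hcosh x y = 1 \<longleftrightarrow> x = y"
proof
  assume "hcosh x y = 1"
  then have "tens y (x - y) (x - y) / ((gap x)\<^sup>2 * (gap y)\<^sup>2) = 0"
    using hcosh_sq[OF assms] by simp
  then have "tens y (x - y) (x - y) = 0"
    using gap_pos[OF assms(1)] gap_pos[OF assms(2)] by simp
  then show "x = y" using tens_pos[OF assms(2), of "x - y"] by force
next
  assume "x = y"
  then show "hcosh x y = 1"
    unfolding hcosh_def \<open>x = y\<close> gap_sq[OF assms(2), symmetric]
    using gap_pos[OF assms(2)] by (simp add: power2_eq_square)
qed

lemma hdist_hcosh: "hdist x y = arcosh (hcosh x y)"
  unfolding hdist_def hcosh_def gap_def real_sqrt_mult ..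

lemma cosh_hdist: "x \<in> hplane \<Longrightarrow> y \<in> hplane \<Longrightarrow> cosh (hdist x y) = hcosh x y"
  by (simp add: hdist_hcosh hcosh_ge_1)

lemma hdist_nonneg: "x \<in> hplane \<Longrightarrow> y \<in> hplane \<Longrightarrow> hdist x y \<ge> 0"
  by (simp add: hdist_hcosh hcosh_ge_1)

lemma hdist_commute: "hdist x y = hdist y x"
  unfolding hdist_hcosh hcosh_commute[of x y] ..

lemma hdist_eq_0_iff: "x \<in> hplane \<Longrightarrow> y \<in> hplane \<Longrightarrow> hdist x y = 0 \<longleftrightarrow> x = y"
  by (simp add: hdist_hcosh hcosh_ge_1 hcosh_eq_1_iff)

lemma hdist_le_iff_hcosh:
  assumes "x \<in> hplane" "y \<in> hplane" "z \<in> hplane" "w \<in> hplane"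
  shows "hdist x y \<le> hdist z w \<longleftrightarrow> hcosh x y \<le> hcosh z w"
  using cosh_real_nonneg_le_iff[OF hdist_nonneg[OF assms(1,2)] hdist_nonneg[OF assms(3,4)]]
  by (simp add: cosh_hdist assms)

lemma sinh_hdist_sq:
  assumes "x \<in> hplane" "y \<in> hplane"
  shows "(sinh (hdist x y))\<^sup>2 = tens y (x - y) (x - y) / ((gap x)\<^sup>2 * (gap y)\<^sup>2)"
  using hcosh_sq[OF assms] unfolding cosh_hdist[OF assms, symmetric] cosh_square_eq by linarith

text \<open>Hyperbolic law of cosines at \<open>y\<close>: the right-hand side is the product of the
  two \<open>sinh\<close> values and the cosine of the angle, with the angle encoded by the inner
  product \<open>tens y\<close>.\<close>

lemma tens_eq_hcosh:
  assumes "x \<in> hplane" "y \<in> hplane" "z \<in> hplane"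
  shows "hcosh x y * hcosh y z - hcosh x z = tens y (x - y) (z - y) / (gap x * (gap y)\<^sup>2 * gap z)"
proof -
  have "a / (p * q) * (b / (q * r)) - c / (p * r) = (a * b - c * q\<^sup>2) / (p * q\<^sup>2 * r)"
    if "p > 0" "q > 0" "r > 0" for a b c p q r :: real
    using that by (simp add: field_simps power2_eq_square)
  from this[OF assms[THEN gap_pos]] show ?thesis
    unfolding tens_diff[OF assms(2)] hcosh_def .
qed

text \<open>Cauchy-Schwarz for \<open>tens y\<close> bounds the angle term of the law of cosines by
  the product of the \<open>sinh\<close> values; the addition formula for \<open>cosh\<close> does
  the rest.\<close>

lemma hdist_triangle:
  assumes "x \<in> hplane" "y \<in> hplane" "z \<in> hplane"
  shows "hdist x z \<le> hdist x y + hdist y z"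
proof -
  let ?s = "sinh (hdist x y)" and ?t = "sinh (hdist y z)"
  have "(hcosh x z - hcosh x y * hcosh y z)\<^sup>2 = (tens y (x - y) (z - y) / (gap x * (gap y)\<^sup>2 * gap z))\<^sup>2"
    unfolding tens_eq_hcosh[OF assms, symmetric] by (rule power2_commute)
  also have "\<dots> \<le> tens y (x - y) (x - y) * tens y (z - y) (z - y) / (gap x * (gap y)\<^sup>2 * gap z)\<^sup>2"
    unfolding power_divide by (intro divide_right_mono tens_Cauchy_Schwarz) auto
  also have "\<dots> = (?s * ?t)\<^sup>2"
    unfolding power_mult_distrib sinh_hdist_sq[OF assms(1,2)]
      hdist_commute[of y z] sinh_hdist_sq[OF assms(3,2)]
    by (simp add: power2_eq_square)
  finally have "hcosh x z - hcosh x y * hcosh y z \<le> ?s * ?t"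
    by (rule power2_le_imp_le)
      (use assms hdist_nonneg in \<open>simp add: sinh_real_nonneg_iff\<close>)
  then have "cosh (hdist x z) \<le> cosh (hdist x y + hdist y z)"
    using assms by (simp add: cosh_add cosh_hdist)
  then show ?thesis
    using assms by (simp add: cosh_real_nonneg_le_iff hdist_nonneg)
qed

text \<open>Equality case of the triangle inequality: \<open>x - z\<close> and \<open>y - z\<close>
  are opposite multiples of one vector, so the angle term equals minus the product of the
  \<open>sinh\<close> values.\<close>

lemma hdist_between:
  assumes "x \<in> hplane" "y \<in> hplane" "z \<in> closed_segment x y"
  shows "hdist x y = hdist x z + hdist z y"
proof -
  have z: "z \<in> hplane"
    using assms closed_segment_subset[OF _ _ convex_hplane] by blast
  obtain t where t: "0 \<le> t" "t \<le> 1" "z = (1 - t) *\<^sub>R x + t *\<^sub>R y"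
    using assms(3) by (auto simp: in_segment)
  let ?h = "y - x" and ?s = "sinh (hdist x z)" and ?s' = "sinh (hdist z y)"
  have xz: "x - z = (- t) *\<^sub>R ?h" and yz: "y - z = (1 - t) *\<^sub>R ?h"
    by (simp_all add: t algebra_simps)
  have gs: "gap x > 0" "gap y > 0" "gap z > 0" using assms z gap_pos by auto
  let ?r = "t * (1 - t) * tens z ?h ?h / (gap x * (gap z)\<^sup>2 * gap y)"
  have "(?s * ?s')\<^sup>2 = ?r\<^sup>2"
    unfolding power_mult_distrib sinh_hdist_sq[OF assms(1) z]
      hdist_commute[of z y] sinh_hdist_sq[OF assms(2) z] xz yz tens_scaleR
    by (simp add: power2_eq_square mult_ac)
  moreover have "?r \<ge> 0"
    using t gs tens_nonneg by (intro divide_nonneg_nonneg mult_nonneg_nonneg) auto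
  moreover have "?s * ?s' \<ge> 0"
    using assms z hdist_nonneg by (simp add: sinh_real_nonneg_iff)
  ultimately have "?s * ?s' = ?r" by (metis power2_eq_imp_eq)
  moreover have "hcosh x z * hcosh z y - hcosh x y = - ?r"
    unfolding tens_eq_hcosh[OF assms(1) z assms(2)] xz yz tens_scaleR by simp
  ultimately have "cosh (hdist x y) = cosh (hdist x z + hdist z y)"
    using assms z by (simp add: cosh_add cosh_hdist)
  then show ?thesis
    using assms z hdist_nonneg
    by (metis abs_of_nonneg add_nonneg_nonneg cosh_real_eq_iff)
qed

subsection \<open>Geodesic arcs are segments\<close>

text \<open>
  The hyperboloid parametrisation \<open>s \<mapsto> (sinh (d - s) X + sinh s Y) / sinh d\<close> of the geodesic
  through \<open>X\<close> and \<open>Y\<close>, projected to the Klein disc; it needs \<open>x \<noteq> y\<close>.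
\<close>

definition hseg :: "complex \<Rightarrow> complex \<Rightarrow> real \<Rightarrow> complex" where
  "hseg x y s = (let l = sinh (hdist x y - s) / gap x; m = sinh s / gap y
     in (l / (l + m)) *\<^sub>R x + (m / (l + m)) *\<^sub>R y)"

lemma hseg_props:
  assumes "x \<in> hplane" "y \<in> hplane" "x \<noteq> y" "s \<in> {0..hdist x y}"
  shows hseg_in_segment: "hseg x y s \<in> closed_segment x y"
    and hcosh_hseg: "p \<in> hplane \<Longrightarrow>
      hcosh (hseg x y s) p = (sinh (hdist x y - s) * hcosh x p + sinh s * hcosh y p) / sinh (hdist x y)"
proof -
  define d where "d = hdist x y"
  have d: "d > 0" using assms hdist_nonneg hdist_eq_0_iff unfolding d_def by (metis less_eq_real_def)
  have s: "0 \<le> s" "s \<le> d" using assms(4) by (auto simp: d_def)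
  define l m where "l = sinh (d - s) / gap x" and "m = sinh s / gap y"
  have gs: "gap x > 0" "gap y > 0" using assms gap_pos by auto
  have l0: "l \<ge> 0" and m0: "m \<ge> 0" using gs s by (auto simp: l_def m_def)
  have lm: "l + m > 0"
  proof (cases "s = 0")
    case True
    then have "l > 0" using gs d by (simp add: l_def)
    then show ?thesis using m0 by simp
  next
    case False
    then have "m > 0" using gs s by (simp add: m_def)
    then show ?thesis using l0 by simp
  qed
  have c: "hseg x y s = (l / (l + m)) *\<^sub>R x + (m / (l + m)) *\<^sub>R y"
    by (simp add: hseg_def Let_def l_def m_def d_def)
  have "l / (l + m) = 1 - m / (l + m)" using lm by (simp add: field_simps)
  then show seg: "hseg x y s \<in> closed_segment x y"
    unfolding c in_segment using l0 m0 lm by (intro exI[of _ "m / (l + m)"]) auto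
  then have ch: "hseg x y s \<in> hplane"
    using assms closed_segment_subset[OF _ _ convex_hplane] by blast
  \<comment> \<open>The combination l (1, x) + m (1, y) equals (l + m) (1,
    \<open>hseg x y s\<close>); this is its pairing with (1, p).\<close>
  have lin: "(l + m) * (1 - hseg x y s \<bullet> p) = l * (1 - x \<bullet> p) + m * (1 - y \<bullet> p)" for p
  proof -
    have "hseg x y s \<bullet> p = (l * (x \<bullet> p) + m * (y \<bullet> p)) / (l + m)"
      unfolding c by (simp add: inner_add_left add_divide_distrib)
    then have "(l + m) * (hseg x y s \<bullet> p) = l * (x \<bullet> p) + m * (y \<bullet> p)"
      using lm by simp
    then show ?thesis by (simp add: algebra_simps)
  qed
  have xy: "1 - x \<bullet> y = gap x * gap y * cosh d"
    using gs assms by (simp add: d_def cosh_hdist hcosh_def)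
  \<comment> \<open>Lorentz square of the same combination. Its value is the square of
    \<open>sinh d\<close>, which is why division by \<open>sinh d\<close> normalises the
    parametrisation.\<close>
  have "(l + m)\<^sup>2 * (gap (hseg x y s))\<^sup>2 = (l + m) * ((l + m) * (1 - hseg x y s \<bullet> hseg x y s))"
    unfolding gap_sq[OF ch] by (simp add: power2_eq_square)
  also have "\<dots> = l * ((l + m) * (1 - hseg x y s \<bullet> x)) + m * ((l + m) * (1 - hseg x y s \<bullet> y))"
    unfolding lin[of "hseg x y s"] by (simp add: inner_commute algebra_simps)
  also have "\<dots> = l * (l * (1 - x \<bullet> x) + m * (1 - y \<bullet> x)) + m * (l * (1 - x \<bullet> y) + m * (1 - y \<bullet> y))"
    unfolding lin ..
  also have "\<dots> = (l * gap x)\<^sup>2 + (m * gap y)\<^sup>2 + 2 * (l * gap x) * (m * gap y) * cosh d"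
    unfolding inner_commute[of y x] xy gap_sq[OF assms(1), symmetric] gap_sq[OF assms(2), symmetric]
    by (simp add: power2_eq_square algebra_simps)
  also have "\<dots> = (sinh (d - s))\<^sup>2 + (sinh s)\<^sup>2 + 2 * sinh (d - s) * sinh s * cosh d"
    using gs by (simp add: l_def m_def)
  also have "\<dots> = (sinh d)\<^sup>2"
  proof -
    have "(sinh (d - s))\<^sup>2 + (sinh s)\<^sup>2 + 2 * sinh (d - s) * sinh s * cosh d
        = (sinh d)\<^sup>2 * (cosh s)\<^sup>2 + (sinh s)\<^sup>2 * (1 - (cosh d)\<^sup>2)"
      by (simp add: sinh_diff power2_eq_square algebra_simps)
    also have "\<dots> = (sinh d)\<^sup>2 * ((cosh s)\<^sup>2 - (sinh s)\<^sup>2)"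
      by (simp add: cosh_square_eq algebra_simps)
    also have "\<dots> = (sinh d)\<^sup>2" by (simp add: cosh_square_eq)
    finally show ?thesis .
  qed
  finally have "((l + m) * gap (hseg x y s))\<^sup>2 = (sinh d)\<^sup>2" by (simp add: power_mult_distrib)
  then have g: "(l + m) * gap (hseg x y s) = sinh d"
    by (rule power2_eq_imp_eq) (use lm gap_pos[OF ch] d in auto)
  show "hcosh (hseg x y s) p = (sinh (hdist x y - s) * hcosh x p + sinh s * hcosh y p) / sinh (hdist x y)"
    if p: "p \<in> hplane"
  proof -
    have gp: "gap p > 0" using p gap_pos by blast
    have "hcosh (hseg x y s) p = ((l + m) * (1 - hseg x y s \<bullet> p)) / (((l + m) * gap (hseg x y s)) * gap p)"
      using lm by (simp add: hcosh_def)
    also have "\<dots> = (l * (1 - x \<bullet> p) + m * (1 - y \<bullet> p)) / (sinh d * gap p)"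
      unfolding lin g ..
    also have "\<dots> = (sinh (d - s) * hcosh x p + sinh s * hcosh y p) / sinh d"
      using gs gp d by (simp add: hcosh_def l_def m_def field_simps)
    finally show ?thesis by (simp add: d_def)
  qed
qed

lemma hseg_in_hplane:
  assumes "x \<in> hplane" "y \<in> hplane" "x \<noteq> y" "s \<in> {0..hdist x y}"
  shows "hseg x y s \<in> hplane"
  using hseg_in_segment[OF assms] assms closed_segment_subset[OF _ _ convex_hplane] by blast

lemma geodesic_hseg:
  assumes "x \<in> hplane" "y \<in> hplane" "x \<noteq> y"
  shows "geodesic_path hdist hplane (hseg x y) x y"
proof -
  define d where "d = hdist x y"
  have d: "d > 0" using assms hdist_nonneg hdist_eq_0_iff unfolding d_def by (metis less_eq_real_def)
  note K = hcosh_hseg[OF assms, folded d_def]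
  note H = hseg_in_hplane[OF assms, folded d_def]
  have cx: "hcosh x (hseg x y s) = cosh s" and cy: "hcosh y (hseg x y s) = cosh (d - s)"
    if "s \<in> {0..d}" for s
  proof -
    have c: "hcosh x y = cosh d" "hcosh y x = cosh d" "hcosh x x = 1" "hcosh y y = 1"
      using assms by (auto simp: d_def cosh_hdist hcosh_commute hcosh_eq_1_iff)
    have "hcosh x (hseg x y s) = (sinh (d - s) + sinh s * cosh d) / sinh d"
      using K[OF that assms(1)] c by (simp add: hcosh_commute)
    then show "hcosh x (hseg x y s) = cosh s" using d by (simp add: sinh_diff mult.commute)
    have "hcosh y (hseg x y s) = (sinh (d - s) * cosh d + sinh s) / sinh d"
      using K[OF that assms(2)] c by (simp add: hcosh_commute)
    also have "sinh (d - s) * cosh d + sinh s = sinh d * cosh (d - s)"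
    proof -
      have "sinh (d - s) * cosh d + sinh s - sinh d * cosh (d - s)
          = sinh s * (1 - ((cosh d)\<^sup>2 - (sinh d)\<^sup>2))"
        by (simp add: sinh_diff cosh_diff algebra_simps power2_eq_square)
      then show ?thesis by (simp add: cosh_square_eq)
    qed
    finally show "hcosh y (hseg x y s) = cosh (d - s)" using d by simp
  qed
  have dd: "hdist (hseg x y s) (hseg x y t) = \<bar>s - t\<bar>" if st: "s \<in> {0..d}" "t \<in> {0..d}" for s t
  proof -
    have "hcosh (hseg x y s) (hseg x y t) = (sinh (d - s) * cosh t + sinh s * cosh (d - t)) / sinh d"
      using K[OF st(1) H[OF st(2)]] cx[OF st(2)] cy[OF st(2)] by simp
    also have "sinh (d - s) * cosh t + sinh s * cosh (d - t) = sinh d * cosh (s - t)"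
      by (simp add: sinh_diff cosh_diff algebra_simps)
    finally have "cosh (hdist (hseg x y s) (hseg x y t)) = cosh (s - t)"
      using d H st by (simp add: cosh_hdist)
    then show ?thesis using hdist_nonneg[OF H[OF st(1)] H[OF st(2)]] by simp
  qed
  have "hseg x y 0 = x" "hseg x y d = y"
    using d gap_pos[OF assms(1)] gap_pos[OF assms(2)] by (auto simp: hseg_def Let_def d_def)
  then show ?thesis
    unfolding geodesic_path_def d_def[symmetric] using dd H by auto
qed

text \<open>Uniqueness of geodesics: \<open>z\<close> and the point at parameter
  \<open>hdist x z\<close> have \<open>hcosh\<close> equal to 1, by the addition formula for
  \<open>sinh\<close>.\<close>

lemma hseg_eqI:
  assumes "x \<in> hplane" "y \<in> hplane" "x \<noteq> y"
    and "z \<in> hplane" "hdist x z + hdist z y = hdist x y"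
  shows "hdist x z \<in> {0..hdist x y}" "hseg x y (hdist x z) = z"
proof -
  define d s where "d = hdist x y" and "s = hdist x z"
  have d: "d > 0" using assms hdist_nonneg hdist_eq_0_iff unfolding d_def by (metis less_eq_real_def)
  show s: "hdist x z \<in> {0..hdist x y}"
    using assms hdist_nonneg[of x z] hdist_nonneg[of z y] by auto
  have "hdist y z = d - s" using assms by (simp add: s_def d_def hdist_commute[of y z])
  then have "hcosh x z = cosh s" "hcosh y z = cosh (d - s)"
    using assms cosh_hdist[of x z] cosh_hdist[of y z] by (auto simp: s_def)
  then have "hcosh (hseg x y s) z = (sinh (d - s) * cosh s + sinh s * cosh (d - s)) / sinh d"
    using hcosh_hseg[OF assms(1-3) s assms(4)] by (simp add: d_def s_def)
  also have "sinh (d - s) * cosh s + sinh s * cosh (d - s) = sinh d"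
    using sinh_add[of "d - s" s] by (simp add: algebra_simps)
  finally show "hseg x y (hdist x z) = z"
    using d hcosh_eq_1_iff[OF hseg_in_hplane[OF assms(1-3) s] assms(4)] by (simp add: s_def)
qed

text \<open>A purely metric description of chords, so that distance-preserving maps carry segments
  to segments without any formula for the maps.\<close>

lemma closed_segment_iff_hdist:
  assumes "x \<in> hplane" "y \<in> hplane"
  shows "z \<in> closed_segment x y \<longleftrightarrow> z \<in> hplane \<and> hdist x z + hdist z y = hdist x y"
proof
  assume "z \<in> closed_segment x y"
  then show "z \<in> hplane \<and> hdist x z + hdist z y = hdist x y"
    using hdist_between[OF assms] assms closed_segment_subset[OF _ _ convex_hplane] by fastforce
next
  assume z: "z \<in> hplane \<and> hdist x z + hdist z y = hdist x y"
  show "z \<in> closed_segment x y"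
  proof (cases "x = y")
    case True
    then show ?thesis
      using z assms hdist_nonneg[of x z] hdist_eq_0_iff[of x z] hdist_eq_0_iff[of x y]
      by (simp add: hdist_commute)
  next
    case False
    then show ?thesis
      using z hseg_eqI[OF assms False, of z] hseg_in_segment[OF assms False, of "hdist x z"] by simp
  qed
qed

lemma geodesic_arc_eq_segment:
  assumes "x \<in> hplane" "y \<in> hplane"
  shows "geodesic_arc x y = closed_segment x y"
proof
  show "geodesic_arc x y \<subseteq> closed_segment x y"
  proof
    fix z assume "z \<in> geodesic_arc x y"
    then obtain c s where c: "geodesic_path hdist hplane c x y" and s: "s \<in> {0..hdist x y}" "z = c s"
      by (auto simp: geodesic_arc_def)
    have c0: "c 0 = x" and cd: "c (hdist x y) = y" and cs: "c s \<in> hplane"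
      using c s(1) unfolding geodesic_path_def by auto
    have "0 \<in> {0..hdist x y}" "hdist x y \<in> {0..hdist x y}"
      using hdist_nonneg[OF assms] by auto
    then have "hdist (c 0) (c s) = \<bar>0 - s\<bar>" "hdist (c s) (c (hdist x y)) = \<bar>s - hdist x y\<bar>"
      using c s(1) unfolding geodesic_path_def by blast+
    then have "hdist x (c s) + hdist (c s) y = hdist x y"
      unfolding c0 cd using s(1) by auto
    then show "z \<in> closed_segment x y"
      using cs s(2) closed_segment_iff_hdist[OF assms] by simp
  qed
  show "closed_segment x y \<subseteq> geodesic_arc x y"
  proof
    fix z assume z: "z \<in> closed_segment x y"
    have *: "\<exists>c s. geodesic_path hdist hplane c x y \<and> s \<in> {0..hdist x y} \<and> z = c s"
    proof (cases "x = y")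
      case True
      then have "geodesic_path hdist hplane (\<lambda>_. x) x y"
        using assms hdist_eq_0_iff[of x x] by (auto simp: geodesic_path_def)
      then show ?thesis using True z hdist_nonneg[OF assms] by auto
    next
      case False
      have "z \<in> hplane" "hdist x z + hdist z y = hdist x y"
        using z closed_segment_iff_hdist[OF assms] by auto
      then show ?thesis using geodesic_hseg[OF assms False] hseg_eqI[OF assms False] by metis
    qed
    then show "z \<in> geodesic_arc x y" unfolding geodesic_arc_def by blast
  qed
qed

lemma hconvex_iff: "hconvex C \<longleftrightarrow> C \<subseteq> hplane \<and> convex C"
proof (cases "C \<subseteq> hplane")
  case True
  then have "geodesic_arc x y = closed_segment x y" if "x \<in> C" "y \<in> C" for x y
    using that by (intro geodesic_arc_eq_segment) auto
  then show ?thesis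
    using True by (simp add: hconvex_def convex_contains_segment)
qed (simp add: hconvex_def)

lemma hconvex_hull_eq:
  assumes "A \<subseteq> hplane"
  shows "hconvex hull A = convex hull A"
proof
  have "convex hull A \<subseteq> hplane" using assms by (simp add: convex_hplane subset_hull)
  then show "hconvex hull A \<subseteq> convex hull A"
    by (intro hull_minimal) (auto simp: hconvex_iff hull_subset)
  show "convex hull A \<subseteq> hconvex hull A"
    unfolding hull_def by (auto simp: hconvex_iff)
qed

subsection \<open>Balls\<close>

text \<open>The graph of \<open>gap\<close> is a hemisphere. After squaring, concavity reduces to
  the reversed Cauchy-Schwarz inequality, which is \<open>hcosh_ge_1\<close>.\<close>

lemma gap_concave:
  assumes "p \<in> hplane" "q \<in> hplane" "0 \<le> t" "t \<le> 1"
  shows "(1 - t) * gap p + t * gap q \<le> gap ((1 - t) *\<^sub>R p + t *\<^sub>R q)"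
proof -
  let ?z = "(1 - t) *\<^sub>R p + t *\<^sub>R q"
  have z: "?z \<in> hplane" using assms by (intro convexD[OF convex_hplane]) auto
  have "gap p * gap q \<le> 1 - p \<bullet> q"
    using hcosh_ge_1[OF assms(1,2)] gap_pos[OF assms(1)] gap_pos[OF assms(2)]
    by (simp add: hcosh_def)
  then have "2 * (t * (1 - t)) * (gap p * gap q) \<le> 2 * (t * (1 - t)) * (1 - p \<bullet> q)"
    using assms by (intro mult_left_mono) auto
  then have "((1 - t) * gap p + t * gap q)\<^sup>2 \<le> (gap ?z)\<^sup>2"
    unfolding gap_sq[OF z] power2_sum power_mult_distrib gap_sq[OF assms(1)] gap_sq[OF assms(2)]
    by (simp add: power2_eq_square algebra_simps inner_commute)
  then show ?thesis by (rule power2_le_imp_le) (use gap_pos[OF z] in simp)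
qed

lemma hdist_le_iff:
  assumes "v \<in> hplane" "z \<in> hplane" "R \<ge> 0"
  shows "hdist v z \<le> R \<longleftrightarrow> 1 - v \<bullet> z \<le> cosh R * gap v * gap z"
    and "hdist v z < R \<longleftrightarrow> 1 - v \<bullet> z < cosh R * gap v * gap z"
proof -
  have g: "gap v * gap z > 0" using assms gap_pos by simp
  have "hdist v z \<le> R \<longleftrightarrow> hcosh v z \<le> cosh R" "hdist v z < R \<longleftrightarrow> hcosh v z < cosh R"
    using assms cosh_hdist cosh_real_nonneg_le_iff cosh_real_nonneg_less_iff hdist_nonneg by metis+
  then show "hdist v z \<le> R \<longleftrightarrow> 1 - v \<bullet> z \<le> cosh R * gap v * gap z"
    "hdist v z < R \<longleftrightarrow> 1 - v \<bullet> z < cosh R * gap v * gap z"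
    using g by (simp_all add: hcosh_def field_simps)
qed

text \<open>A ball about \<open>v\<close> is where an affine function of \<open>z\<close> is at most
  a positive multiple of the concave function \<open>gap z\<close>. Strictness comes from
  \<open>p\<close>, whose weight is positive because \<open>z\<close> differs from
  \<open>q\<close>.\<close>

lemma hball_strict_convex:
  assumes "v \<in> hplane" "p \<in> hplane" "q \<in> hplane" "hdist v p < R" "hdist v q \<le> R"
    and "z \<in> closed_segment p q" "z \<noteq> q"
  shows "hdist v z < R"
proof -
  obtain t where t: "0 \<le> t" "t \<le> 1" "z = (1 - t) *\<^sub>R p + t *\<^sub>R q"
    using assms(6) by (auto simp: in_segment)
  with assms(7) have t1: "t < 1" by (cases "t = 1") auto
  have z: "z \<in> hplane" using t assms by (auto intro: convexD[OF convex_hplane])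
  have R: "R \<ge> 0" using assms hdist_nonneg by (meson less_le_not_le order_trans less_imp_le)
  let ?C = "cosh R * gap v"
  have "(1 - t) * (1 - v \<bullet> p) + t * (1 - v \<bullet> q) < (1 - t) * (?C * gap p) + t * (?C * gap q)"
    using assms R t t1 by (intro add_less_le_mono mult_strict_left_mono mult_left_mono)
      (auto simp: hdist_le_iff)
  also have "\<dots> = ?C * ((1 - t) * gap p + t * gap q)" by (simp add: algebra_simps)
  also have "\<dots> \<le> ?C * gap z"
    unfolding t(3) using assms t gap_pos[OF assms(1)] by (intro mult_left_mono gap_concave) auto
  finally have "1 - v \<bullet> z < ?C * gap z" by (simp add: t(3) inner_add_right algebra_simps)
  then show ?thesis using hdist_le_iff(2)[OF assms(1) z R] by simp
qed

lemma convex_hcball: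
  assumes "v \<in> hplane"
  shows "convex {z \<in> hplane. hdist v z \<le> R}"
proof (rule convexI)
  fix p q and u t :: real
  assume pq: "p \<in> {z \<in> hplane. hdist v z \<le> R}" "q \<in> {z \<in> hplane. hdist v z \<le> R}"
    and ut: "0 \<le> u" "0 \<le> t" "u + t = 1"
  let ?z = "u *\<^sub>R p + t *\<^sub>R q"
  have z: "?z \<in> hplane" using pq ut by (auto intro: convexD[OF convex_hplane])
  have R: "R \<ge> 0" using pq assms hdist_nonneg[of v p] by auto
  have u: "u = 1 - t" using ut by simp
  let ?C = "cosh R * gap v"
  have "u * (1 - v \<bullet> p) + t * (1 - v \<bullet> q) \<le> u * (?C * gap p) + t * (?C * gap q)"
    using assms R ut pq by (intro add_mono mult_left_mono) (auto simp: hdist_le_iff)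
  also have "\<dots> = ?C * (u * gap p + t * gap q)" by (simp add: algebra_simps)
  also have "\<dots> \<le> ?C * gap ?z"
    unfolding u using assms pq ut gap_pos[OF assms(1)] by (intro mult_left_mono gap_concave) auto
  finally have "1 - v \<bullet> ?z \<le> ?C * gap ?z" by (simp add: u inner_add_right algebra_simps)
  then show "?z \<in> {z \<in> hplane. hdist v z \<le> R}" using hdist_le_iff(1)[OF assms z R] z by simp
qed

text \<open>Hyperbolic balls stay away from the unit circle: 1 - p \<bullet> v is at least 1 - |p|,
  which forces a positive lower bound \<open>e\<close> on \<open>gap v\<close>. This is the source
  of compactness later on.\<close>

lemma hcball_norm_bound:
  assumes "p \<in> hplane"
  obtains r where "r < 1" "\<And>v. v \<in> hplane \<Longrightarrow> hdist p v \<le> C \<Longrightarrow> norm v \<le> r"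
proof -
  define e where "e = (1 - norm p) / (cosh C * gap p)"
  have e: "e > 0" using assms gap_pos by (simp add: e_def hplane_iff)
  have "norm v \<le> sqrt (1 - e\<^sup>2)" if v: "v \<in> hplane" "hdist p v \<le> C" for v
  proof -
    have "C \<ge> 0" using hdist_nonneg[OF assms v(1)] v(2) by simp
    then have "1 - p \<bullet> v \<le> cosh C * gap p * gap v" using hdist_le_iff(1) assms v by simp
    moreover have "p \<bullet> v \<le> norm p * norm v" by (rule norm_cauchy_schwarz)
    moreover have "norm p * norm v \<le> norm p * 1"
      using v by (intro mult_left_mono) (auto simp: hplane_iff)
    ultimately have "1 - norm p \<le> cosh C * gap p * gap v" by simp
    then have "e \<le> gap v"
      using gap_pos[OF assms] by (simp add: e_def divide_le_eq mult.commute)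
    then have "e\<^sup>2 \<le> 1 - (norm v)\<^sup>2"
      using e power_mono[of e "gap v" 2] gap_sq[OF v(1)] by (simp add: power2_norm_eq_inner)
    then show ?thesis by (intro real_le_rsqrt) simp
  qed
  moreover have "sqrt (1 - e\<^sup>2) < 1" using e by simp
  ultimately show thesis using that by blast
qed

lemma continuous_on_gap [continuous_intros]: "continuous_on S gap"
  unfolding gap_def by (intro continuous_intros)

lemma continuous_on_hcosh:
  "x \<in> hplane \<Longrightarrow> continuous_on hplane (hcosh x)"
  unfolding hcosh_def
  by (intro continuous_intros) (use gap_pos in \<open>auto simp: less_imp_neq[symmetric]\<close>)

lemma continuous_on_hdist:
  assumes "x \<in> hplane"
  shows "continuous_on hplane (hdist x)"
  unfolding hdist_hcosh
  by (rule continuous_on_compose2[OF continuous_on_arcosh continuous_on_hcosh[OF assms] order.refl])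
    (use assms hcosh_ge_1 in auto)

lemma open_hball: "x \<in> hplane \<Longrightarrow> open (hball x r)"
  using continuous_open_preimage[OF continuous_on_hdist open_hplane, of x "{..<r}"]
  by (simp add: hball_def vimage_def Int_def)

lemma centre_in_hball: "x \<in> hplane \<Longrightarrow> r > 0 \<Longrightarrow> x \<in> hball x r"
  using hdist_eq_0_iff[of x x] by (simp add: hball_def)

section \<open>Centered edges and vertex polygons\<close>

lemma orthogonal_complex_cases:
  fixes h u :: complex
  assumes "h \<noteq> 0" "h \<bullet> u = 0"
  obtains k where "u = k *\<^sub>R (\<i> * h)"
proof
  have h: "Re h * Re h + Im h * Im h \<noteq> 0"
    using assms(1) by (simp add: complex_eq_iff sum_squares_eq_zero_iff)
  have o: "Re h * Re u + Im h * Im u = 0" using assms(2) by (simp add: inner_complex_def)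
  define N d where "N = Re h * Re h + Im h * Im h" and "d = Re h * Im u - Im h * Re u"
  have "Re u * N = - d * Im h" "Im u * N = d * Re h"
    using o unfolding N_def d_def by algebra+
  then have "Re u = - d * Im h / N" "Im u = d * Re h / N"
    by (simp_all only: nonzero_eq_divide_eq[OF h[folded N_def]])
  then show "u = (d / N) *\<^sub>R (\<i> * h)"
    by (intro complex_eqI) simp_all
qed

text \<open>The Lorentz product of (1, u) with the lift of \<open>x\<close>. It is affine in
  \<open>u\<close> and, on the disc, equals \<open>cosh (hdist u x)\<close> times a factor
  \<open>gap u\<close> that does not depend on \<open>x\<close>; nearest sites are thus minimisers
  of affine functions.\<close>

definition hform :: "complex \<Rightarrow> complex \<Rightarrow> real" where
  "hform x u = (1 - u \<bullet> x) / gap x"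

lemma hform_affine: "hform x ((1 - t) *\<^sub>R a + t *\<^sub>R b) = (1 - t) * hform x a + t * hform x b"
proof -
  have "1 - ((1 - t) *\<^sub>R a + t *\<^sub>R b) \<bullet> x = (1 - t) * (1 - a \<bullet> x) + t * (1 - b \<bullet> x)"
    by (simp add: inner_add_left algebra_simps)
  then show ?thesis by (simp add: hform_def add_divide_distrib)
qed

lemma hcosh_hform: "hcosh v x = hform x v / gap v"
  by (simp add: hcosh_def hform_def mult.commute)

lemma hdist_le_iff_hform:
  assumes "v \<in> hplane" "x \<in> hplane" "y \<in> hplane"
  shows "hdist v x \<le> hdist v y \<longleftrightarrow> hform x v \<le> hform y v"
  unfolding hdist_le_iff_hcosh[OF assms(1,2) assms(1,3)] hcosh_hform
  using gap_pos[OF assms(1)] by (simp add: divide_le_cancel)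

lemma hdist_eq_iff_hform:
  assumes "v \<in> hplane" "x \<in> hplane" "y \<in> hplane"
  shows "hdist v x = hdist v y \<longleftrightarrow> hform x v = hform y v"
  using hdist_le_iff_hform[OF assms] hdist_le_iff_hform[OF assms(1,3,2)] by auto

text \<open>
  Lifted to the hyperboloid, points equidistant from \<open>a\<close> and from \<open>b\<close> are collinear, and a line
  meets the hyperboloid at most twice.
\<close>

lemma hcircles_meet_twice:
  assumes H: "a \<in> hplane" "b \<in> hplane" "x \<in> hplane" "y \<in> hplane" "z \<in> hplane"
    and "a \<noteq> b" "x \<noteq> y"
    and a: "hform x a = hform y a" "hform x a = hform z a"
    and b: "hform x b = hform y b" "hform x b = hform z b"
  shows "z = x \<or> z = y"
proof -
  \<comment> \<open>Time and space components of the difference between the lifts of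
    \<open>x\<close> and \<open>w\<close>. A point \<open>u\<close> equidistant from both satisfies
    \<open>d w\<close> = u \<bullet> \<open>e w\<close>.\<close>
  define d where "d = (\<lambda>w. 1 / gap x - 1 / gap w)"
  define e where "e = (\<lambda>w. (1 / gap x) *\<^sub>R x - (1 / gap w) *\<^sub>R w)"
  have de: "d w = u \<bullet> e w" if "hform x u = hform w u" for u w
    using that by (simp add: hform_def d_def e_def inner_diff_right diff_divide_distrib)
  have d0: "w = x" if "d w = 0" "e w = 0" "w \<in> hplane" for w
  proof -
    have "1 / gap w = 1 / gap x" using that(1) by (simp add: d_def)
    then have "(1 / gap x) *\<^sub>R x = (1 / gap x) *\<^sub>R w" using that(2) by (simp add: e_def)
    then show ?thesis using gap_pos[OF H(3)] by simp
  qed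
  \<comment> \<open>Both space components are orthogonal to \<open>b - a\<close>, hence parallel in
    the plane; this is the collinearity of the three lifts.\<close>
  have "(b - a) \<bullet> e w = 0" if "w = y \<or> w = z" for w
    using that de[OF a(1)] de[OF a(2)] de[OF b(1)] de[OF b(2)] by (auto simp: inner_diff_left)
  then obtain k1 k2 where k: "e y = k1 *\<^sub>R (\<i> * (b - a))" "e z = k2 *\<^sub>R (\<i> * (b - a))"
    using \<open>a \<noteq> b\<close> by (metis orthogonal_complex_cases right_minus_eq)
  have k1: "k1 \<noteq> 0"
    using d0[of y] \<open>x \<noteq> y\<close> H(4) k(1) de[OF a(1)] by auto
  define r where "r = k2 / k1"
  have ez: "e z = r *\<^sub>R e y" using k k1 by (simp add: r_def)
  have dz: "d z = r * d y" using de[OF a(2)] de[OF a(1)] ez by simp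
  \<comment> \<open>Both lifts have Lorentz square 1; expanding the square of their difference gives
    this relation. Along the line of lifts it becomes a quadratic equation for the ratio
    \<open>r\<close>, with roots 0 and 1.\<close>
  have q: "2 * (d w / gap x - x \<bullet> e w / gap x) = (d w)\<^sup>2 - e w \<bullet> e w" if "w \<in> hplane" for w
  proof -
    have u: "(1 / gap u)\<^sup>2 - ((1 / gap u) *\<^sub>R u) \<bullet> ((1 / gap u) *\<^sub>R u) = 1" if "u \<in> hplane" for u
    proof -
      have "(1 / gap u)\<^sup>2 - ((1 / gap u) *\<^sub>R u) \<bullet> ((1 / gap u) *\<^sub>R u) = (1 / gap u)\<^sup>2 * (1 - u \<bullet> u)"
        by (simp add: power2_eq_square diff_divide_distrib)
      also have "\<dots> = 1"
        unfolding gap_sq[OF that, symmetric] using gap_pos[OF that] by (simp flip: power_mult_distrib)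
      finally show ?thesis .
    qed
    have "1 / gap w = 1 / gap x - d w" "(1 / gap w) *\<^sub>R w = (1 / gap x) *\<^sub>R x - e w"
      by (simp_all add: d_def e_def)
    with u[OF that] have "(1 / gap x - d w)\<^sup>2 - ((1 / gap x) *\<^sub>R x - e w) \<bullet> ((1 / gap x) *\<^sub>R x - e w) = 1"
      by metis
    with u[OF H(3)] show ?thesis
      by (simp add: power2_eq_square inner_diff_left inner_diff_right inner_commute algebra_simps)
  qed
  have "r * ((d y)\<^sup>2 - e y \<bullet> e y) = 2 * (d z / gap x - x \<bullet> e z / gap x)"
    unfolding q[OF H(4), symmetric] ez dz by (simp add: algebra_simps)
  also have "\<dots> = r\<^sup>2 * ((d y)\<^sup>2 - e y \<bullet> e y)"
    unfolding q[OF H(5)] unfolding ez dz by (simp add: power2_eq_square algebra_simps)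
  finally have "(r - r\<^sup>2) * ((d y)\<^sup>2 - e y \<bullet> e y) = 0" by (simp add: algebra_simps)
  \<comment> \<open>The secant is spacelike, so the factor can be cancelled.\<close>
  moreover have "(d y)\<^sup>2 < e y \<bullet> e y"
  proof -
    have "e y \<noteq> 0" using k(1) k1 \<open>a \<noteq> b\<close> by simp
    have "\<bar>d y\<bar> \<le> norm a * norm (e y)" unfolding de[OF a(1)] by (rule Cauchy_Schwarz_ineq2)
    also have "\<dots> < 1 * norm (e y)"
      using H(1) \<open>e y \<noteq> 0\<close> by (intro mult_strict_right_mono) (auto simp: hplane_iff)
    finally have "\<bar>d y\<bar>\<^sup>2 < (norm (e y))\<^sup>2" by (intro power_strict_mono) auto
    then show ?thesis by (simp add: power2_norm_eq_inner)
  qed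
  ultimately have "r = 0 \<or> r = 1" by (auto simp: power2_eq_square)
  then show ?thesis
  proof
    assume "r = 0" then show ?thesis using d0[OF _ _ H(5)] dz ez by simp
  next
    assume "r = 1"
    then have e: "d z = d y" "e z = e y" using dz ez by auto
    then have "1 / gap z = 1 / gap y" by (simp add: d_def)
    then have "(1 / gap y) *\<^sub>R z = (1 / gap y) *\<^sub>R y" using e(2) by (simp add: e_def)
    then show ?thesis using gap_pos[OF H(4)] by simp
  qed
qed

section \<open>Nearest sites, vertices and centered pairs\<close>

definition sites_at :: "complex set \<Rightarrow> complex \<Rightarrow> complex set" where
  "sites_at T v = {x \<in> T. \<forall>y\<in>T. hdist v x \<le> hdist v y}"

lemma voronoi_cell_iff: "v \<in> voronoi_cell T x \<longleftrightarrow> v \<in> hplane \<and> (\<forall>y\<in>T. hdist v x \<le> hdist v y)"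
  by (auto simp: voronoi_cell_def)

lemma vertex_polygon_eq:
  assumes "T \<subseteq> hplane" "v \<in> hplane"
  shows "vertex_polygon T v = convex hull (sites_at T v)"
proof -
  have "{x \<in> T. v \<in> voronoi_cell T x} = sites_at T v"
    using assms by (auto simp: voronoi_cell_iff sites_at_def)
  then show ?thesis
    using assms hconvex_hull_eq[of "sites_at T v"] by (auto simp: vertex_polygon_def sites_at_def)
qed

lemma voronoi_vertices_iff:
  "v \<in> voronoi_vertices T \<longleftrightarrow> v \<in> hplane \<and>
    (\<exists>x y z. x \<noteq> y \<and> y \<noteq> z \<and> x \<noteq> z \<and> {x, y, z} \<subseteq> sites_at T v)"
  unfolding voronoi_vertices_def sites_at_def by (auto simp: voronoi_cell_iff)

text \<open>Centeredness in terms of distances alone: \<open>m\<close> is the midpoint of the dual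
  arc, and the closed disc about it through \<open>x\<close> and \<open>y\<close> contains no third
  site. In this form isometries preserving \<open>T\<close> transport it directly.\<close>

definition centered_pair :: "complex set \<Rightarrow> complex \<Rightarrow> complex \<Rightarrow> bool" where
  "centered_pair T x y \<longleftrightarrow> x \<in> T \<and> y \<in> T \<and> x \<noteq> y \<and>
    (\<exists>m\<in>hplane. hdist x m + hdist m y = hdist x y \<and> hdist m x = hdist m y \<and>
       (\<forall>z \<in> T - {x, y}. hdist m x < hdist m z))"

text \<open>The point is the strict inequality at \<open>m\<close>. A third site \<open>z\<close> as
  close to \<open>m\<close> as \<open>x\<close> is makes the affine function
  \<open>hform z - hform x\<close>, nonnegative at \<open>a\<close> and \<open>b\<close>, vanish at
  both. Then \<open>x\<close>, \<open>y\<close>, \<open>z\<close> lie on a circle about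
  \<open>a\<close> and on one about \<open>b\<close>, which is impossible for three distinct
  points.\<close>

lemma centered_edge_imp_pair:
  assumes T: "T \<subseteq> hplane" and c: "centered_edge T x y"
  shows "centered_pair T x y"
proof -
  let ?e = "voronoi_cell T x \<inter> voronoi_cell T y"
  have xy: "x \<in> T" "y \<in> T" "x \<noteq> y" using c by (auto simp: centered_edge_def voronoi_edge_def)
  then have xyH: "x \<in> hplane" "y \<in> hplane" using T by auto
  obtain m a b where m: "m \<in> ?e" "m \<in> geodesic_arc x y" "a \<in> ?e" "b \<in> ?e" "m \<in> geodesic_arc a b"
    "m \<noteq> a" "m \<noteq> b"
    using c by (auto simp: centered_edge_def Let_def arc_interior_def)
  have H: "m \<in> hplane" "a \<in> hplane" "b \<in> hplane" using m by (auto simp: voronoi_cell_iff)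
  have "m \<in> closed_segment a b" using m H geodesic_arc_eq_segment by auto
  then obtain t where t: "0 \<le> t" "t \<le> 1" "m = (1 - t) *\<^sub>R a + t *\<^sub>R b"
    by (auto simp: in_segment)
  have t01: "0 < t" "t < 1" using t m(6,7) by (cases "t = 0"; cases "t = 1"; force)+
  have ab: "a \<noteq> b" using m(5-7) H geodesic_arc_eq_segment[of a a] by auto
  have eq: "hform x u = hform y u" and ge: "z \<in> T \<Longrightarrow> hform x u \<le> hform z u"
    if "u \<in> ?e" for u z
  proof -
    have "u \<in> hplane" "hdist u x = hdist u y" "z \<in> T \<Longrightarrow> hdist u x \<le> hdist u z"
      using that xy by (auto simp: voronoi_cell_iff intro: order.antisym)
    then show "hform x u = hform y u" "z \<in> T \<Longrightarrow> hform x u \<le> hform z u"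
      using hdist_eq_iff_hform[of u x y] hdist_le_iff_hform[of u x z] xyH T by auto
  qed
  have "hdist m x < hdist m z" if z: "z \<in> T - {x, y}" for z
  proof (rule ccontr)
    assume "\<not> hdist m x < hdist m z"
    then have le: "hform z m \<le> hform x m"
      using hdist_le_iff_hform[of m z x] H xyH z T by auto
    have zH: "z \<in> hplane" using z T by auto
    have ga: "hform x a \<le> hform z a" and gb: "hform x b \<le> hform z b"
      using ge m(3,4) z by auto
    have "(1 - t) * (hform z a - hform x a) + t * (hform z b - hform x b) \<le> 0"
      using le unfolding t(3) hform_affine by (simp add: algebra_simps)
    moreover have "(1 - t) * (hform z a - hform x a) \<ge> 0" "t * (hform z b - hform x b) \<ge> 0"
      using ga gb t by auto
    ultimately have "(1 - t) * (hform z a - hform x a) = 0" "t * (hform z b - hform x b) = 0"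
      by linarith+
    then have "hform x a = hform z a" "hform x b = hform z b" using t01 by auto
    then have "z = x \<or> z = y"
      using hcircles_meet_twice[OF H(2,3) xyH zH ab xy(3)] eq m(3,4) by blast
    then show False using z by auto
  qed
  moreover have "hdist x m + hdist m y = hdist x y"
    using m(2) closed_segment_iff_hdist[OF xyH] geodesic_arc_eq_segment[OF xyH] by auto
  moreover have "hdist m x = hdist m y"
    using eq[OF m(1)] hdist_eq_iff_hform[OF H(1) xyH] by simp
  ultimately show ?thesis
    unfolding centered_pair_def using xy H by blast
qed

lemma sites_at_radius:
  assumes "a \<in> sites_at T v" "b \<in> sites_at T v"
  shows "hdist v a = hdist v b"
  using assms by (auto simp: sites_at_def intro: order.antisym)

lemma vertex_polygon_radius:
  assumes "T \<subseteq> hplane" "v \<in> hplane" "a \<in> sites_at T v" "p \<in> convex hull (sites_at T v)"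
  shows "p \<in> hplane" "hdist v p \<le> hdist v a"
proof -
  have "sites_at T v \<subseteq> {z \<in> hplane. hdist v z \<le> hdist v a}"
    using assms(1,3) by (auto simp: sites_at_def)
  then have "convex hull (sites_at T v) \<subseteq> {z \<in> hplane. hdist v z \<le> hdist v a}"
    by (rule hull_minimal) (rule convex_hcball[of v "hdist v a", OF assms(2)])
  then show "p \<in> hplane" "hdist v p \<le> hdist v a" using assms(4) by auto
qed

text \<open>
  If a spoke crossed \<open>[x, y]\<close>, some site \<open>a\<close> at \<open>v\<close> would lie beyond the line \<open>xy\<close>.  The point \<open>z\<close>
  where \<open>[v, a]\<close> meets this line is at least as close to \<open>a\<close> as to \<open>x\<close> and \<open>y\<close>, so \<open>a\<close> would lie in
  the disc with diameter \<open>[x, y]\<close>, which contains no third site.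
\<close>

lemma centered_pair_misses_spoke:
  assumes T: "T \<subseteq> hplane" and v: "v \<in> voronoi_vertices T"
    and p: "p \<in> convex hull (sites_at T v)" and q: "q \<in> closed_segment v p" "q \<noteq> p"
    and xy: "centered_pair T x y"
  shows "q \<notin> closed_segment x y"
proof
  assume qxy: "q \<in> closed_segment x y"
  let ?A = "sites_at T v"
  have vH: "v \<in> hplane" using v by (simp add: voronoi_vertices_iff)
  obtain a1 a2 a3 where as: "a1 \<noteq> a2" "a2 \<noteq> a3" "a1 \<noteq> a3" "{a1, a2, a3} \<subseteq> ?A"
    using v by (auto simp: voronoi_vertices_iff)
  define R where "R = hdist v a1"
  have RA: "hdist v a = R" if "a \<in> ?A" for a
    using sites_at_radius[OF that, of a1] as by (simp add: R_def)
  have RT: "R \<le> hdist v z" if "z \<in> T" for z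
    using as that by (auto simp: R_def sites_at_def)
  have pH: "p \<in> hplane" and pR: "hdist v p \<le> R"
    using vertex_polygon_radius[OF T vH, of a1 p] as p by (auto simp: R_def)
  have xyT: "x \<in> T" "y \<in> T" "x \<noteq> y" using xy by (auto simp: centered_pair_def)
  then have xyH: "x \<in> hplane" "y \<in> hplane" using T by auto
  obtain m where m: "m \<in> hplane" "hdist x m + hdist m y = hdist x y" "hdist m x = hdist m y"
      "\<And>z. z \<in> T - {x, y} \<Longrightarrow> hdist m x < hdist m z"
    using xy by (auto simp: centered_pair_def)
  have qH: "q \<in> hplane" "hdist v q + hdist q p = hdist v p"
    using q(1) closed_segment_iff_hdist[OF vH pH] by auto
  have "hdist q p > 0" using q(2) qH(1) pH hdist_eq_0_iff hdist_nonneg by (metis less_eq_real_def)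
  then have qR: "hdist v q < R" using qH pR by simp
  \<comment> \<open>Signed offset of \<open>u\<close> from the line through \<open>x\<close> and
    \<open>y\<close>; multiplication by \<open>\<i>\<close> turns the direction into a
    normal.\<close>
  define n where "n = (\<lambda>u. (\<i> * (y - x)) \<bullet> (u - x))"
  have n_aff: "n ((1 - t) *\<^sub>R u + t *\<^sub>R w) = (1 - t) * n u + t * n w" for t u w
    by (simp add: n_def inner_diff_right inner_add_right algebra_simps)
  have n_line: "\<exists>k. u = x + k *\<^sub>R (y - x)" if "n u = 0" for u
  proof -
    have "\<i> * (y - x) \<noteq> 0" using xyT by simp
    then obtain k where "u - x = k *\<^sub>R (\<i> * (\<i> * (y - x)))"
      using orthogonal_complex_cases \<open>n u = 0\<close> unfolding n_def by metis
    then have "u = x + (- k) *\<^sub>R (y - x)" by (simp add: complex_eq_iff algebra_simps)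
    then show ?thesis by blast
  qed
  have n_xy: "n (x + k *\<^sub>R (y - x)) = 0" for k
    by (simp add: n_def inner_complex_def algebra_simps)
  obtain j where j: "0 \<le> j" "j \<le> 1" "q = x + j *\<^sub>R (y - x)"
    using qxy by (auto simp: in_segment algebra_simps)
  obtain t where t: "0 \<le> t" "t \<le> 1" "q = (1 - t) *\<^sub>R v + t *\<^sub>R p"
    using q(1) by (auto simp: in_segment)
  have t1: "t < 1" using t q(2) by (cases "t = 1") auto
  \<comment> \<open>A site weakly across the line from \<open>v\<close>. If \<open>v\<close> is on
    the line, any of three sites other than \<open>x\<close> and \<open>y\<close> will do.
    Otherwise, with all sites on the side of \<open>v\<close>, so would be \<open>p\<close>, and
    then \<open>q\<close>, which has positive weight at \<open>v\<close>, would be off the line. A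
    strict sign excludes \<open>x\<close> and \<open>y\<close>, where \<open>n\<close>
    vanishes.\<close>
  have "\<exists>a\<in>?A. a \<noteq> x \<and> a \<noteq> y \<and> n v * n a \<le> 0"
  proof (cases "n v = 0")
    case True
    have "a1 \<notin> {x, y} \<or> a2 \<notin> {x, y} \<or> a3 \<notin> {x, y}" using as(1-3) by auto
    then show ?thesis using as(4) True by auto
  next
    case False
    have "\<exists>a\<in>?A. n v * n a < 0"
    proof (rule ccontr)
      assume "\<not> (\<exists>a\<in>?A. n v * n a < 0)"
      then have sub: "?A \<subseteq> {u. n v * n u \<ge> 0}" by (auto simp: not_less)
      have "convex {u. n v * n u \<ge> 0}"
      proof (rule convexI)
        fix u w and c d :: real
        assume uw: "u \<in> {u. n v * n u \<ge> 0}" "w \<in> {u. n v * n u \<ge> 0}" and cd: "0 \<le> c" "0 \<le> d" "c + d = 1"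
        have c: "c = 1 - d" using cd by simp
        have "n v * n (c *\<^sub>R u + d *\<^sub>R w) = c * (n v * n u) + d * (n v * n w)"
          unfolding c n_aff by (simp add: algebra_simps)
        then show "c *\<^sub>R u + d *\<^sub>R w \<in> {u. n v * n u \<ge> 0}" using uw cd by simp
      qed
      then have np: "n v * n p \<ge> 0" using hull_minimal[of ?A _ convex, OF sub] p by blast
      moreover have "(1 - t) * n v + t * n p = 0" using n_xy[of j] n_aff[of t v p] j t by simp
      then have "(1 - t) * (n v * n v) + t * (n v * n p) = 0"
        by (metis (no_types, opaque_lifting) distrib_left mult.left_commute mult_zero_right)
      moreover have "(1 - t) * (n v * n v) > 0"
        by (rule mult_pos_pos) (use t1 False in \<open>auto simp: zero_less_mult_iff\<close>)
      moreover have "t * (n v * n p) \<ge> 0" using t np by simp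
      ultimately show False by linarith
    qed
    moreover have "n x = 0" "n y = 0" using n_xy[of 0] n_xy[of 1] by auto
    ultimately show ?thesis by (metis less_irrefl less_imp_le mult_zero_right)
  qed
  then obtain a where a: "a \<in> ?A" "a \<noteq> x" "a \<noteq> y" "n v * n a \<le> 0" by blast
  have aT: "a \<in> T" using a by (auto simp: sites_at_def)
  then have aH: "a \<in> hplane" using T by auto
  have "\<exists>s. 0 \<le> s \<and> s \<le> 1 \<and> (1 - s) * n v + s * n a = 0"
  proof (cases "n v = 0")
    case True then show ?thesis by (intro exI[of _ 0]) auto
  next
    case False
    then have "n v > 0 \<and> n a \<le> 0 \<or> n v < 0 \<and> n a \<ge> 0" using a(4) by (auto simp: mult_le_0_iff)
    then show ?thesis
      by (intro exI[of _ "n v / (n v - n a)"]) (auto simp: field_simps divide_le_eq)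
  qed
  then obtain s where s: "0 \<le> s" "s \<le> 1" "(1 - s) * n v + s * n a = 0" by blast
  define z where "z = (1 - s) *\<^sub>R v + s *\<^sub>R a"
  have "z \<in> closed_segment v a" unfolding z_def in_segment using s by blast
  then have z: "z \<in> hplane" "hdist v z + hdist z a = R"
    using closed_segment_iff_hdist[OF vH aH] RA[OF a(1)] by auto
  have zR: "hdist v z \<le> R" using z hdist_nonneg[OF z(1) aH] by simp
  obtain k where k: "z = x + k *\<^sub>R (y - x)"
    using n_line[of z] n_aff[of s v a] s(3) by (auto simp: z_def)
  \<comment> \<open>If \<open>z\<close> lay beyond \<open>y\<close>, then \<open>y\<close> would be
    on the chord from \<open>q\<close> to \<open>z\<close>, hence in the open disc of radius
    \<open>R\<close> about \<open>v\<close>, which contains no site. The strict inequality at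
    \<open>q\<close> is where \<open>q\<close> differing from \<open>p\<close> matters.\<close>
  have "k \<le> 1"
  proof (rule ccontr)
    assume k1: "\<not> k \<le> 1"
    define u where "u = (1 - j) / (k - j)"
    have u: "0 \<le> u" "u \<le> 1" "j + u * (k - j) = 1" using k1 j by (auto simp: u_def)
    have "(1 - u) *\<^sub>R q + u *\<^sub>R z = x + (j + u * (k - j)) *\<^sub>R (y - x)"
      unfolding j(3) k by (simp add: algebra_simps)
    then have "y \<in> closed_segment q z" unfolding in_segment using u by (intro exI[of _ u]) auto
    moreover have "y \<noteq> z"
    proof
      assume "y = z"
      then have "(k - 1) *\<^sub>R (y - x) = 0" unfolding k by (auto simp: algebra_simps)
      then show False using k1 xyT by simp
    qed
    ultimately have "hdist v y < R" using hball_strict_convex[OF vH qH(1) z(1) qR zR] by blast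
    then show False using RT[OF xyT(2)] by simp
  qed
  moreover have "0 \<le> k"
  proof (rule ccontr)
    assume k1: "\<not> 0 \<le> k"
    define u where "u = j / (j - k)"
    have u: "0 \<le> u" "u \<le> 1" "j + u * (k - j) = 0" using k1 j by (auto simp: u_def field_simps)
    have "(1 - u) *\<^sub>R q + u *\<^sub>R z = x + (j + u * (k - j)) *\<^sub>R (y - x)"
      unfolding j(3) k by (simp add: algebra_simps)
    then have "x \<in> closed_segment q z" unfolding in_segment using u by (intro exI[of _ u]) auto
    moreover have "x \<noteq> z" using k k1 xyT by simp
    ultimately have "hdist v x < R" using hball_strict_convex[OF vH qH(1) z(1) qR zR] by blast
    then show False using RT[OF xyT(1)] by simp
  qed
  ultimately have "z \<in> closed_segment x y"
    unfolding in_segment k by (intro exI[of _ k]) (auto simp: algebra_simps)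
  moreover have mxy: "m \<in> closed_segment x y" using m closed_segment_iff_hdist[OF xyH] by auto
  ultimately consider "z \<in> closed_segment x m" | "z \<in> closed_segment m y"
    using Un_closed_segment[OF mxy] by auto
  \<comment> \<open>From \<open>z\<close> the site \<open>a\<close> is no farther than
    \<open>x\<close> or \<open>y\<close>: going on from \<open>z\<close> to \<open>a\<close>
    completes a path of length \<open>R\<close> from \<open>v\<close>, and no site is nearer to
    \<open>v\<close> than that.\<close>
  then have "hdist m a \<le> hdist m x"
  proof cases
    case 1
    have "hdist m a \<le> hdist m z + hdist z a" using hdist_triangle m(1) z(1) aH by blast
    also have "hdist z a \<le> hdist z x"
      using hdist_triangle[OF vH z(1) xyH(1)] RT[OF xyT(1)] z(2) by simp
    also have "hdist m z + hdist z x = hdist m x"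
      using 1 closed_segment_iff_hdist[OF xyH(1) m(1)] by (simp add: hdist_commute add.commute)
    finally show ?thesis by simp
  next
    case 2
    have "hdist m a \<le> hdist m z + hdist z a" using hdist_triangle m(1) z(1) aH by blast
    also have "hdist z a \<le> hdist z y"
      using hdist_triangle[OF vH z(1) xyH(2)] RT[OF xyT(2)] z(2) by simp
    also have "hdist m z + hdist z y = hdist m x"
      using 2 closed_segment_iff_hdist[OF m(1) xyH(2)] m(3) by simp
    finally show ?thesis by simp
  qed
  then show False using m(4)[of a] aT a(2,3) by auto
qed

section \<open>The vertex polygons cover the plane\<close>

lemma hform_eq: "v \<in> hplane \<Longrightarrow> x \<in> hplane \<Longrightarrow> hform x v = cosh (hdist v x) * gap v"
  using gap_pos[of v] by (simp add: cosh_hdist hcosh_hform)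

lemma hform_pos: "v \<in> hplane \<Longrightarrow> x \<in> hplane \<Longrightarrow> hform x v > 0"
  using gap_pos[of v] by (simp add: hform_eq)

lemma continuous_on_hform [continuous_intros]:
  "continuous_on S f \<Longrightarrow> continuous_on S (\<lambda>s. hform x (f s))"
  unfolding hform_def divide_inverse by (intro continuous_intros)

lemma hform_shift: "hform x (v + e *\<^sub>R h) = hform x v - e * ((h \<bullet> x) / gap x)"
  by (simp add: hform_def inner_add_left diff_divide_distrib add_divide_distrib)

text \<open>Local finiteness is expressed by the compact discs exhausting the plane;
  \<open>D\<close> is a covering radius.\<close>

locale net =
  fixes T :: "complex set" and D :: real
  assumes sub_hplane: "T \<subseteq> hplane"
    and finite_cball: "r < 1 \<Longrightarrow> finite (T \<inter> cball 0 r)"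
    and dense: "v \<in> hplane \<Longrightarrow> \<exists>x\<in>T. hdist v x \<le> D"
begin

lemma in_hplane: "x \<in> T \<Longrightarrow> x \<in> hplane"
  using sub_hplane by auto

lemma D_nonneg: "D \<ge> 0"
proof -
  have "0 \<in> hplane" by (simp add: hplane_iff)
  then obtain x where "x \<in> T" "hdist 0 x \<le> D" using dense by blast
  then show ?thesis using hdist_nonneg[of 0 x] in_hplane \<open>0 \<in> hplane\<close> by auto
qed

lemma finite_near:
  assumes "v \<in> hplane"
  shows "finite {x \<in> T. hdist v x \<le> C}"
proof -
  obtain r where r: "r < 1" "\<And>x. x \<in> hplane \<Longrightarrow> hdist v x \<le> C \<Longrightarrow> norm x \<le> r"
    using hcball_norm_bound[OF assms, of C] by metis
  then have "{x \<in> T. hdist v x \<le> C} \<subseteq> T \<inter> cball 0 r" using in_hplane by auto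
  then show ?thesis using finite_cball[OF r(1)] finite_subset by blast
qed

lemma sites_at_near:
  assumes "v \<in> hplane" "a \<in> sites_at T v"
  shows "hdist v a \<le> D"
  using dense[OF assms(1)] assms(2) by (auto simp: sites_at_def intro: order_trans)

text \<open>For positive \<mu>, the plane through (1, p) / \<mu> that is Lorentz-orthogonal to (1,
  v) leaves no lifted site strictly below it.\<close>

definition feasible :: "complex \<Rightarrow> real \<Rightarrow> complex \<Rightarrow> bool" where
  "feasible p \<mu> v \<longleftrightarrow> v \<in> hplane \<and> (\<forall>x\<in>T. 1 - v \<bullet> p \<le> \<mu> * hform x v)"

text \<open>The constraint of a site within \<open>D\<close> of \<open>v\<close> already confines
  \<open>v\<close> to a ball about \<open>p\<close>. The bound \<open>gap p\<close> is the value of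
  \<mu> that makes \<open>v = p\<close> feasible, so nothing is lost in minimising below it.\<close>

lemma feasible_near:
  assumes "p \<in> hplane" "feasible p \<mu> v" "\<mu> \<le> gap p"
  shows "hdist p v \<le> D"
proof -
  have v: "v \<in> hplane" using assms(2) by (simp add: feasible_def)
  obtain x where x: "x \<in> T" "hdist v x \<le> D" using dense[OF v] by blast
  have g: "gap p > 0" "gap v > 0" using assms v gap_pos by auto
  have "cosh (hdist p v) * gap v * gap p = 1 - v \<bullet> p"
    using hform_eq[OF v assms(1)] g by (simp add: hform_def hdist_commute divide_eq_eq)
  also have "\<dots> \<le> \<mu> * hform x v" using assms(2) x by (simp add: feasible_def)
  also have "\<dots> \<le> gap p * hform x v"
    using assms(3) hform_pos[OF v in_hplane[OF x(1)]] by (intro mult_right_mono) auto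
  also have "\<dots> = cosh (hdist v x) * gap v * gap p"
    by (simp add: hform_eq[OF v in_hplane[OF x(1)]])
  also have "\<dots> \<le> cosh D * gap v * gap p"
    using g x hdist_nonneg[OF v in_hplane[OF x(1)]] D_nonneg
    by (intro mult_right_mono) (auto simp: cosh_real_nonneg_le_iff)
  finally have "cosh (hdist p v) \<le> cosh D" using g by simp
  then show ?thesis
    using hdist_nonneg[OF assms(1) v] D_nonneg by (simp add: cosh_real_nonneg_le_iff)
qed

lemma feasible_pos:
  assumes "p \<in> hplane" "feasible p \<mu> v"
  shows "\<mu> > 0"
proof -
  have v: "v \<in> hplane" using assms(2) by (simp add: feasible_def)
  obtain x where x: "x \<in> T" "hdist v x \<le> D" using dense[OF v] by blast
  have "0 < 1 - v \<bullet> p" using inner_hplane_less_1[OF v, of p] assms(1) by (simp add: hplane_iff)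
  also have "\<dots> \<le> \<mu> * hform x v" using assms(2) x by (simp add: feasible_def)
  finally show ?thesis using hform_pos[OF v in_hplane[OF x(1)]] by (simp add: zero_less_mult_iff)
qed

text \<open>Two successive optimisations over compact sets: least \<mu>, then largest norm among the
  optimal \<open>v\<close>. The radius \<open>r\<close> below 1 replaces the open disc by a closed
  one without losing any feasible point for \<mu> up to \<open>gap p\<close>.\<close>

lemma extremal_feasible:
  assumes p: "p \<in> hplane"
  obtains \<mu> v where "feasible p \<mu> v" "\<And>\<nu> w. feasible p \<nu> w \<Longrightarrow> \<mu> \<le> \<nu>"
    "\<And>w. feasible p \<mu> w \<Longrightarrow> norm w \<le> norm v"
proof -
  obtain r where r: "r < 1" "\<And>v. v \<in> hplane \<Longrightarrow> hdist p v \<le> D \<Longrightarrow> norm v \<le> r"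
    using hcball_norm_bound[OF p, of D] by metis
  have small: "norm v \<le> r" if "feasible p \<mu> v" "\<mu> \<le> gap p" for \<mu> v
    using r(2) feasible_near[OF p that] that(1) by (auto simp: feasible_def)
  have feas: "feasible p \<mu> v \<longleftrightarrow> (\<forall>x\<in>T. 1 - v \<bullet> p \<le> \<mu> * hform x v)" if "norm v \<le> r" for \<mu> v
    using that r(1) by (simp add: feasible_def hplane_iff)
  let ?K = "({0..gap p} \<times> cball 0 r) \<inter> (\<Inter>x\<in>T. {z. 1 - snd z \<bullet> p \<le> fst z * hform x (snd z)})"
  have "compact ?K"
    by (intro compact_Int_closed compact_Times compact_Icc compact_cball closed_INT ballI
        closed_Collect_le continuous_intros)
  moreover have "feasible p (gap p) p"
  proof -
    have "1 - p \<bullet> p \<le> gap p * hform x p" if "x \<in> T" for x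
      using gap_pos[OF p] cosh_real_ge_1[of "hdist p x"]
      by (simp add: hform_eq[OF p in_hplane[OF that]] gap_sq[OF p, symmetric] power2_eq_square)
    then show ?thesis using p by (simp add: feasible_def)
  qed
  then have ne: "(gap p, p) \<in> ?K"
    using small[of "gap p" p] gap_pos[OF p] feas[of p "gap p"] by auto
  moreover from ne have "?K \<noteq> {}" by blast
  moreover have "continuous_on ?K fst" by (intro continuous_intros)
  ultimately have "\<exists>z\<in>?K. \<forall>y\<in>?K. fst z \<le> fst y" by (intro continuous_attains_inf)
  then obtain z where z: "z \<in> ?K" "\<forall>y\<in>?K. fst z \<le> fst y" by blast
  define \<mu> where "\<mu> = fst z"
  have \<mu>: "0 \<le> \<mu>" "\<mu> \<le> gap p" using z(1) by (auto simp: \<mu>_def)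
  let ?L = "cball 0 r \<inter> (\<Inter>x\<in>T. {v. 1 - v \<bullet> p \<le> \<mu> * hform x v})"
  have "compact ?L"
    by (intro compact_Int_closed compact_cball closed_INT ballI closed_Collect_le continuous_intros)
  moreover have "snd z \<in> ?L" using z(1) by (auto simp: \<mu>_def)
  then have "?L \<noteq> {}" by blast
  moreover have "continuous_on ?L norm" by (intro continuous_intros)
  ultimately have "\<exists>v\<in>?L. \<forall>w\<in>?L. norm w \<le> norm v" by (intro continuous_attains_sup)
  then obtain v where v: "v \<in> ?L" "\<forall>w\<in>?L. norm w \<le> norm v" by blast
  show thesis
  proof
    show "feasible p \<mu> v" using v(1) feas[of v \<mu>] by auto
    show "norm w \<le> norm v" if "feasible p \<mu> w" for w
      using v(2) small[OF that \<mu>(2)] that feas[of w \<mu>] by auto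
    show "\<mu> \<le> \<nu>" if \<nu>: "feasible p \<nu> w" for \<nu> w
    proof (cases "\<nu> \<le> gap p")
      case True
      have "(\<nu>, w) \<in> ?K"
        using small[OF \<nu> True] True feasible_pos[OF p \<nu>] \<nu> feas[of w \<nu>] by auto
      with z(2) have "fst z \<le> fst (\<nu>, w)" by blast
      then show ?thesis by (simp add: \<mu>_def)
    qed (use \<mu> in simp)
  qed
qed

text \<open>Constraints weaken as sites move away from \<open>w\<close>, and some site within
  \<open>D\<close> of \<open>w\<close> exists. For \<open>w\<close> within 1 of \<open>v\<close>,
  the finitely many sites within \<open>D + 1\<close> of \<open>v\<close> therefore decide
  feasibility.\<close>

lemma feasible_local:
  assumes v: "v \<in> hplane" and w: "w \<in> hball v 1" and \<mu>: "\<mu> > 0"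
    and le: "\<And>x. x \<in> T \<Longrightarrow> hdist v x \<le> D + 1 \<Longrightarrow> 1 - w \<bullet> p \<le> \<mu> * hform x w"
  shows "feasible p \<mu> w"
proof -
  have wH: "w \<in> hplane" "hdist v w < 1" using w by (auto simp: hball_def)
  have "1 - w \<bullet> p \<le> \<mu> * hform x w" if x: "x \<in> T" for x
  proof (cases "hdist w x \<le> D")
    case True
    then have "hdist v x \<le> D + 1"
      using hdist_triangle[OF v wH(1) in_hplane[OF x]] wH(2) by simp
    then show ?thesis using le x by blast
  next
    case False
    obtain y where y: "y \<in> T" "hdist w y \<le> D" using dense[OF wH(1)] by blast
    have "hdist v y \<le> D + 1"
      using hdist_triangle[OF v wH(1) in_hplane[OF y(1)]] wH(2) y by simp
    then have "1 - w \<bullet> p \<le> \<mu> * hform y w" using le y by blast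
    also have "\<dots> \<le> \<mu> * hform x w"
      using \<mu> False y hdist_le_iff_hform[OF wH(1) in_hplane[OF y(1)] in_hplane[OF x]]
      by (intro mult_left_mono) auto
    finally show ?thesis .
  qed
  then show ?thesis using wH by (simp add: feasible_def)
qed

lemma eventually_in_hball:
  assumes "v \<in> hplane"
  shows "\<forall>\<^sub>F e in nhds 0. v + e *\<^sub>R h \<in> hball v 1"
proof -
  have "((\<lambda>e. v + e *\<^sub>R h) \<longlongrightarrow> v + 0 *\<^sub>R h) (nhds 0)"
    by (intro tendsto_intros filterlim_ident)
  then show ?thesis
    by (rule topological_tendstoD) (use open_hball[OF assms] centre_in_hball[OF assms] in auto)
qed

lemma eventually_slack:
  assumes "v \<in> hplane" "1 - v \<bullet> p < \<mu> * hform x v"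
  shows "\<forall>\<^sub>F e in nhds 0. 1 - (v + e *\<^sub>R h) \<bullet> p < \<mu> * hform x (v + e *\<^sub>R h)"
proof -
  let ?f = "\<lambda>e. \<mu> * hform x (v + e *\<^sub>R h) - (1 - (v + e *\<^sub>R h) \<bullet> p)"
  have "(?f \<longlongrightarrow> ?f 0) (nhds 0)"
    unfolding hform_shift by (intro tendsto_intros filterlim_ident)
  moreover have "?f 0 > 0" using assms(2) by simp
  ultimately have "\<forall>\<^sub>F e in nhds 0. ?f e > 0" by (rule order_tendstoD)
  then show ?thesis by (auto elim: eventually_mono)
qed

text \<open>
  Linear programming duality: \<open>(1, p) / \<mu>\<close> is where the ray through \<open>(1, p)\<close> enters the convex
  hull of the sites lifted to the hyperboloid, and \<open>v\<close> is polar to a supporting plane there;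
  maximality of \<open>|v|\<close> makes this plane touch along a 2-face.
\<close>

theorem vertex_polygons_cover:
  assumes p: "p \<in> hplane"
  obtains v where "v \<in> voronoi_vertices T" "p \<in> vertex_polygon T v"
proof -
  obtain \<mu> v where opt: "feasible p \<mu> v" "\<And>\<nu> w. feasible p \<nu> w \<Longrightarrow> \<mu> \<le> \<nu>"
    "\<And>w. feasible p \<mu> w \<Longrightarrow> norm w \<le> norm v"
    using extremal_feasible[OF p] by metis
  have v: "v \<in> hplane" and le: "\<And>x. x \<in> T \<Longrightarrow> 1 - v \<bullet> p \<le> \<mu> * hform x v"
    using opt(1) by (auto simp: feasible_def)
  have \<mu>: "\<mu> > 0" using feasible_pos[OF p opt(1)] .
  \<comment> \<open>The active constraints. Since all constraints share the left-hand side, active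
    sites minimise \<open>hform _ v\<close>, i.e. are nearest to \<open>v\<close>.\<close>
  define A where "A = {x \<in> T. 1 - v \<bullet> p = \<mu> * hform x v}"
  define N where "N = {x \<in> T. hdist v x \<le> D + 1}"
  have finN: "finite N" unfolding N_def by (rule finite_near[OF v])
  have N0: "N \<noteq> {}" using dense[OF v] by (force simp: N_def)
  have A_sites: "A \<subseteq> sites_at T v"
  proof
    fix a assume a: "a \<in> A"
    have "hdist v a \<le> hdist v y" if "y \<in> T" for y
    proof -
      have "\<mu> * hform a v \<le> \<mu> * hform y v" using a le[OF that] by (simp add: A_def)
      then show ?thesis
        using \<mu> hdist_le_iff_hform[OF v] in_hplane a that by (auto simp: A_def)
    qed
    then show "a \<in> sites_at T v" using a by (simp add: A_def sites_at_def)
  qed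
  have AN: "A \<subseteq> N"
    using A_sites sites_at_near[OF v] by (force simp: N_def sites_at_def)
  then have finA: "finite A" using finN finite_subset by blast
  have slack: "\<forall>\<^sub>F e in nhds 0. v + e *\<^sub>R h \<in> hball v 1 \<and>
      (\<forall>x\<in>N - A. 1 - (v + e *\<^sub>R h) \<bullet> p < \<mu> * hform x (v + e *\<^sub>R h))" for h
  proof (intro eventually_conj eventually_in_hball[OF v] eventually_ball_finite finite_Diff finN ballI
      eventually_slack[OF v])
    fix x assume "x \<in> N - A"
    then show "1 - v \<bullet> p < \<mu> * hform x v" using le[of x] by (auto simp: A_def N_def)
  qed
  have pA: "p \<in> convex hull A"
  proof (rule ccontr)
    assume "p \<notin> convex hull A"
    moreover have "closed (convex hull A)"
      using finA by (simp add: compact_imp_closed finite_imp_compact_convex_hull)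
    ultimately obtain a b where ab: "a \<bullet> p < b" "\<forall>x\<in>convex hull A. a \<bullet> x > b"
      using separating_hyperplane_closed_point[OF convex_convex_hull] by metis
    \<comment> \<open>Chosen so that moving \<open>v\<close> by \<open>e *\<^sub>R h\<close>
      rescales 1 - v \<bullet> x by 1 + e b and adds e (a \<bullet> x - b), which is positive on
      \<open>A\<close> and negative at \<open>p\<close>: every active constraint gains
      slack.\<close>
    define h where "h = b *\<^sub>R v - a"
    have shift: "1 - (v + e *\<^sub>R h) \<bullet> x = (1 + e * b) * (1 - v \<bullet> x) + e * (a \<bullet> x - b)" for e x
      by (simp add: h_def inner_add_left inner_diff_left algebra_simps)
    have "\<forall>\<^sub>F e in nhds (0::real). 1 + e * b > 0"
    proof -
      have "((\<lambda>e. 1 + e * b) \<longlongrightarrow> 1 + 0 * b) (nhds 0)" by (intro tendsto_intros filterlim_ident)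
      then show ?thesis by (rule order_tendstoD) simp
    qed
    then obtain d where d: "d > 0" "\<And>e. \<bar>e\<bar> < d \<Longrightarrow> v + e *\<^sub>R h \<in> hball v 1 \<and>
      (\<forall>x\<in>N - A. 1 - (v + e *\<^sub>R h) \<bullet> p < \<mu> * hform x (v + e *\<^sub>R h))"
      using slack[of h] unfolding eventually_nhds_metric by (auto simp: dist_real_def)
    define w where "w = v + (d / 2) *\<^sub>R h"
    have wb: "w \<in> hball v 1" using d by (simp add: w_def)
    then have wH: "w \<in> hplane" by (simp add: hball_def)
    have strict: "1 - w \<bullet> p < \<mu> * hform x w" if x: "x \<in> N" for x
    proof (cases "x \<in> A")
      case True
      have g: "gap x > 0" using in_hplane x gap_pos by (auto simp: N_def)
      have "a \<bullet> x > b" using ab(2) True hull_inc by metis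
      have "1 - w \<bullet> p < (1 + d / 2 * b) * (1 - v \<bullet> p)"
        using ab(1) d(1) unfolding w_def shift by (simp add: mult_less_0_iff)
      also have "\<dots> = \<mu> * ((1 + d / 2 * b) * (1 - v \<bullet> x) / gap x)"
        using True by (simp add: A_def hform_def)
      also have "\<dots> < \<mu> * ((1 - w \<bullet> x) / gap x)"
        using \<mu> g d(1) \<open>a \<bullet> x > b\<close> unfolding w_def shift
        by (intro mult_strict_left_mono divide_strict_right_mono) auto
      finally show ?thesis by (simp add: hform_def)
    next
      case False
      then show ?thesis using d(2)[of "d / 2"] d(1) x by (simp add: w_def)
    qed
    \<comment> \<open>The least value for which the constraints from \<open>N\<close> hold at
      \<open>w\<close>. Being below \<mu>, it contradicts minimality.\<close>
    define \<nu> where "\<nu> = Max ((\<lambda>x. (1 - w \<bullet> p) / hform x w) ` N)"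
    have hp: "hform x w > 0" if "x \<in> N" for x
      using that in_hplane hform_pos[OF wH] by (auto simp: N_def)
    have "\<nu> < \<mu>"
      unfolding \<nu>_def using finN N0 strict hp by (auto simp: Max_less_iff divide_less_eq)
    have ge: "(1 - w \<bullet> p) / hform x w \<le> \<nu>" if "x \<in> N" for x
      unfolding \<nu>_def using finN that by (intro Max_ge) auto
    have "1 - w \<bullet> p > 0" using inner_hplane_less_1[OF wH, of p] p by (simp add: hplane_iff)
    then have "\<nu> > 0" using N0 ge hp by (metis all_not_in_conv divide_pos_pos less_le_trans)
    have "1 - w \<bullet> p \<le> \<nu> * hform x w" if "x \<in> T" "hdist v x \<le> D + 1" for x
      using ge[of x] hp[of x] that by (auto simp: N_def divide_le_eq)
    then have "feasible p \<nu> w" using feasible_local[OF v wb \<open>\<nu> > 0\<close>] by blast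
    then show False using opt(2) \<open>\<nu> < \<mu>\<close> by fastforce
  qed
  then have "A \<noteq> {}" by auto
  have "\<exists>x y z. x \<noteq> y \<and> y \<noteq> z \<and> x \<noteq> z \<and> {x, y, z} \<subseteq> A"
  proof (rule ccontr)
    assume few: "\<not> ?thesis"
    have "\<exists>x\<in>A. \<exists>y\<in>A. A \<subseteq> {x, y}"
    proof -
      obtain x where x: "x \<in> A" using \<open>A \<noteq> {}\<close> by blast
      show ?thesis
      proof (cases "A \<subseteq> {x}")
        case False
        then obtain y where "y \<in> A" "y \<noteq> x" by blast
        then have "A \<subseteq> {x, y}" using few x by blast
        then show ?thesis using x \<open>y \<in> A\<close> by blast
      qed (use x in auto)
    qed
    then obtain x y where xy: "x \<in> A" "y \<in> A" "A \<subseteq> {x, y}" by blast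
    have "p \<in> convex hull {x, y}" using pA hull_mono[OF xy(3)] by blast
    then obtain \<beta> where \<beta>: "0 \<le> \<beta>" "\<beta> \<le> 1" "p = (1 - \<beta>) *\<^sub>R x + \<beta> *\<^sub>R y"
      by (auto simp: segment_convex_hull[symmetric] in_segment)
    have g: "gap x > 0" "gap y > 0" using xy in_hplane gap_pos by (auto simp: A_def)
    \<comment> \<open>Space part of the difference of the two lifts. Along a direction
      \<open>h\<close> orthogonal to it, \<open>hform x\<close> and \<open>hform y\<close> change by
      the same amount, so both active constraints stay equalities.\<close>
    define u where "u = (1 / gap x) *\<^sub>R x - (1 / gap y) *\<^sub>R y"
    obtain h :: complex where h: "h \<noteq> 0" "h \<bullet> u = 0"
    proof (cases "u = 0")
      case True then show thesis using that[of 1] by simp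
    next
      case False then show thesis using that[of "\<i> * u"] by (simp add: inner_complex_def)
    qed
    have hxy: "(h \<bullet> x) / gap x = (h \<bullet> y) / gap y"
      using h(2) by (simp add: u_def inner_diff_right)
    have eq0: "hform x v = hform y v" using xy \<mu> by (auto simp: A_def)
    have eqe: "hform y (v + e *\<^sub>R h) = hform x (v + e *\<^sub>R h)" for e
      using eq0 hxy by (simp add: hform_shift)
    have "1 - w \<bullet> p = ((1 - \<beta>) * gap x) * hform x w + (\<beta> * gap y) * hform y w" for w
    proof -
      have "gap x * hform x w = 1 - w \<bullet> x" "gap y * hform y w = 1 - w \<bullet> y"
        using g by (simp_all add: hform_def)
      then show ?thesis
        by (simp only: \<beta>(3) mult.assoc inner_add_right inner_scaleR_right) (simp add: algebra_simps)
    qed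
    then have comb: "1 - (v + e *\<^sub>R h) \<bullet> p = ((1 - \<beta>) * gap x + \<beta> * gap y) * hform x (v + e *\<^sub>R h)" for e
      by (simp add: eqe distrib_right)
    have "((1 - \<beta>) * gap x + \<beta> * gap y) * hform x v = \<mu> * hform x v"
    proof -
      have "1 - v \<bullet> p = \<mu> * hform x v" using xy(1) by (simp add: A_def)
      then show ?thesis using comb[of 0] by (simp only: scaleR_zero_left add_0_right)
    qed
    moreover have "hform x v \<noteq> 0" using hform_pos[OF v, of x] xy in_hplane by (auto simp: A_def)
    ultimately have \<mu>_eq: "(1 - \<beta>) * gap x + \<beta> * gap y = \<mu>" by simp
    obtain d where d: "d > 0" "\<And>e. \<bar>e\<bar> < d \<Longrightarrow> v + e *\<^sub>R h \<in> hball v 1 \<and>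
      (\<forall>x\<in>N - A. 1 - (v + e *\<^sub>R h) \<bullet> p < \<mu> * hform x (v + e *\<^sub>R h))"
      using slack[of h] unfolding eventually_nhds_metric by (auto simp: dist_real_def)
    have "feasible p \<mu> (v + e *\<^sub>R h)" if e: "\<bar>e\<bar> < d" for e
    proof (rule feasible_local[OF v _ \<mu>])
      show "v + e *\<^sub>R h \<in> hball v 1" using d(2)[OF e] by blast
      fix z assume "z \<in> T" "hdist v z \<le> D + 1"
      then have z: "z \<in> N" by (simp add: N_def)
      show "1 - (v + e *\<^sub>R h) \<bullet> p \<le> \<mu> * hform z (v + e *\<^sub>R h)"
      proof (cases "z \<in> A")
        case True
        then have "z = x \<or> z = y" using xy(3) by blast
        then show ?thesis using comb[of e] eqe[of e] \<mu>_eq by auto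
      next
        case False
        then show ?thesis using d(2)[OF e] z by (simp add: less_imp_le)
      qed
    qed
    then have "norm (v + e *\<^sub>R h) \<le> norm v" if "\<bar>e\<bar> < d" for e using opt(3) that by blast
    then have "(norm (v + e *\<^sub>R h))\<^sup>2 \<le> (norm v)\<^sup>2" if "\<bar>e\<bar> < d" for e
      using that by (intro power_mono) auto
    note sq = this
    \<comment> \<open>The points \<open>v + e *\<^sub>R h\<close> are feasible for both signs of
      \<open>e\<close> with the same \<mu>. By the parallelogram law one of an opposite pair is
      longer than \<open>v\<close>.\<close>
    have "(norm (v + (d / 2) *\<^sub>R h))\<^sup>2 + (norm (v + (- (d / 2)) *\<^sub>R h))\<^sup>2 \<le> 2 * (norm v)\<^sup>2"
      using sq[of "d / 2"] sq[of "- (d / 2)"] d(1) by linarith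
    moreover have "(norm (v + (d / 2) *\<^sub>R h))\<^sup>2 + (norm (v + (- (d / 2)) *\<^sub>R h))\<^sup>2
        = 2 * (norm v)\<^sup>2 + 2 * ((d / 2)\<^sup>2 * (h \<bullet> h))"
      unfolding power2_norm_eq_inner
      by (simp add: inner_add_left inner_add_right inner_diff_left inner_diff_right
          inner_commute power2_eq_square algebra_simps)
    moreover have "(d / 2)\<^sup>2 * (h \<bullet> h) > 0" using d(1) h(1) by simp
    ultimately show False by linarith
  qed
  then have "v \<in> voronoi_vertices T"
    using A_sites v unfolding voronoi_vertices_iff by (meson order_trans)
  moreover have "p \<in> vertex_polygon T v"
    unfolding vertex_polygon_eq[OF sub_hplane v] using pA hull_mono[OF A_sites] by blast
  ultimately show thesis using that by blast
qed

end

section \<open>Coverings of metric spaces by the hyperbolic plane\<close>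

text \<open>The Euclidean metric is dominated near each point, so hyperbolic balls form a
  neighbourhood base for the topology of the disc.\<close>

lemma norm_diff_le_sinh_hdist:
  assumes "x \<in> hplane" "z \<in> hplane"
  shows "norm (x - z) \<le> sinh (hdist x z)"
proof (rule power2_le_imp_le)
  have g: "gap x > 0" "gap z > 0" using assms gap_pos by auto
  have "(gap x)\<^sup>2 \<le> 1" using gap_sq[OF assms(1)] by simp
  then have "(gap x)\<^sup>2 * ((gap z)\<^sup>2 * ((x - z) \<bullet> (x - z))) \<le> 1 * ((gap z)\<^sup>2 * ((x - z) \<bullet> (x - z)))"
    by (intro mult_right_mono) auto
  also have "\<dots> \<le> tens z (x - z) (x - z)" by (simp add: tens_def)
  finally have "(x - z) \<bullet> (x - z) \<le> tens z (x - z) (x - z) / ((gap x)\<^sup>2 * (gap z)\<^sup>2)"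
    using g by (simp add: le_divide_eq mult_ac)
  then show "(norm (x - z))\<^sup>2 \<le> (sinh (hdist x z))\<^sup>2"
    by (simp add: sinh_hdist_sq[OF assms] power2_norm_eq_inner)
  show "0 \<le> sinh (hdist x z)" using hdist_nonneg[OF assms] by simp
qed

lemma hball_subset_open:
  assumes "open U" "z \<in> U" "z \<in> hplane"
  obtains r where "r > 0" "hball z r \<subseteq> U"
proof -
  obtain e where e: "e > 0" "ball z e \<subseteq> U" using assms openE by blast
  have "hball z (arsinh e) \<subseteq> ball z e"
  proof
    fix x assume "x \<in> hball z (arsinh e)"
    then have x: "x \<in> hplane" "hdist z x < arsinh e" by (auto simp: hball_def)
    have "norm (z - x) \<le> sinh (hdist z x)" by (rule norm_diff_le_sinh_hdist[OF assms(3) x(1)])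
    also have "\<dots> < sinh (arsinh e)" using x(2) by (simp only: sinh_real_less_iff)
    finally show "x \<in> ball z e" by (simp add: dist_norm)
  qed
  then show thesis using that[of "arsinh e"] e by auto
qed

text \<open>Bisection glues local estimates by the triangle inequality. It suffices to compare
  parameters on either side of \<open>t\<close>, which is the local case of
  \<open>Bolzano\<close>.\<close>

lemma hdist_le_of_locally_Lipschitz:
  fixes \<gamma> :: "real \<Rightarrow> complex"
  assumes ab: "a \<le> b" and H: "\<And>t. t \<in> {a..b} \<Longrightarrow> \<gamma> t \<in> hplane"
    and loc: "\<And>t. t \<in> {a..b} \<Longrightarrow> \<exists>d>0. \<forall>u\<in>{a..t}. \<forall>v\<in>{t..b}. v - u < d \<longrightarrow>
      hdist (\<gamma> u) (\<gamma> v) \<le> L * (v - u)"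
  shows "hdist (\<gamma> a) (\<gamma> b) \<le> L * (b - a)"
proof -
  define P where "P = (\<lambda>u v. a \<le> u \<and> v \<le> b \<longrightarrow> hdist (\<gamma> u) (\<gamma> v) \<le> L * (v - u))"
  have "P a b" using ab
  proof (induction rule: Bolzano)
    case (trans u v w)
    show ?case unfolding P_def
    proof
      assume uw: "a \<le> u \<and> w \<le> b"
      have "hdist (\<gamma> u) (\<gamma> w) \<le> hdist (\<gamma> u) (\<gamma> v) + hdist (\<gamma> v) (\<gamma> w)"
        using uw trans(3,4) by (intro hdist_triangle H) auto
      also have "\<dots> \<le> L * (v - u) + L * (w - v)"
        using trans uw by (intro add_mono) (auto simp: P_def)
      finally show "hdist (\<gamma> u) (\<gamma> w) \<le> L * (w - u)" by (simp add: algebra_simps)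
    qed
  next
    case (local t)
    then obtain d where "d > 0" "\<forall>u\<in>{a..t}. \<forall>v\<in>{t..b}. v - u < d \<longrightarrow>
      hdist (\<gamma> u) (\<gamma> v) \<le> L * (v - u)"
      using loc[of t] by auto
    then show ?case unfolding P_def by (intro exI[of _ d]) auto
  qed
  then show ?thesis by (simp add: P_def)
qed

text \<open>
  The lifting theorems of the library are stated for covering maps between normed spaces; the
  embedding \<open>x \<mapsto> d(x, -) - d(x\<^sub>0, -)\<close> into bounded functions makes them available for a metric base.
\<close>

lemma Kuratowski_embedding:
  obtains k :: "'a::metric_space \<Rightarrow> 'a \<Rightarrow>\<^sub>C real" where "\<And>x y. dist (k x) (k y) = dist x y"
proof -
  fix o' :: 'a
  define f where "f = (\<lambda>x z::'a. dist x z - dist o' z)"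
  define k where "k = (\<lambda>x. Bcontfun (f x))"
  have "f x \<in> bcontfun" for x
    unfolding f_def
  proof (rule bcontfun_normI)
    show "norm (dist x z - dist o' z) \<le> dist x o'" for z
      using abs_dist_diff_le[of x z o'] by (simp add: dist_commute)
  qed (intro continuous_intros)
  then have k: "apply_bcontfun (k x) z = dist x z - dist o' z" for x z
    by (simp add: k_def Bcontfun_inverse f_def)
  have "dist (k x) (k y) = dist x y" for x y
  proof (rule antisym)
    show "dist (k x) (k y) \<le> dist x y"
    proof (rule dist_bound)
      show "dist (apply_bcontfun (k x) z) (apply_bcontfun (k y) z) \<le> dist x y" for z
        using abs_dist_diff_le[of x z y] by (simp add: k dist_real_def dist_commute)
    qed
    show "dist x y \<le> dist (k x) (k y)"
      using dist_bounded[of "k x" y "k y"] by (simp add: k dist_real_def)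
  qed
  then show thesis by (rule that)
qed

lemma covering_space_homeomorphism_compose:
  assumes cov: "covering_space C p S" and hom: "homeomorphism S S' k k'"
  shows "covering_space C (k \<circ> p) S'"
proof
  have pC: "p ` C = S" and pc: "continuous_on C p"
    using cov by (auto simp: covering_space_def)
  have kS: "k ` S = S'" and kc: "continuous_on S k" and k': "\<And>x. x \<in> S \<Longrightarrow> k' (k x) = x"
    using hom by (auto simp: homeomorphism_def)
  show "continuous_on C (k \<circ> p)" using pc kc pC by (intro continuous_on_compose) auto
  show "(k \<circ> p) ` C = S'" using pC kS by (auto simp: image_comp[symmetric])
  fix y assume "y \<in> S'"
  then obtain x where x: "x \<in> S" "y = k x" using kS by blast
  then obtain T v where T: "x \<in> T" "openin (top_of_set S) T" and v: "\<Union>v = C \<inter> p -` T"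
    "\<forall>u\<in>v. openin (top_of_set C) u" "pairwise disjnt v" "\<forall>u\<in>v. \<exists>q. homeomorphism u T p q"
    using cov unfolding covering_space_def by metis
  have TS: "T \<subseteq> S" using T(2) openin_imp_subset by blast
  show "\<exists>T. y \<in> T \<and> openin (top_of_set S') T \<and> (\<exists>v. \<Union> v = C \<inter> (k \<circ> p) -` T \<and>
      (\<forall>u\<in>v. openin (top_of_set C) u) \<and> pairwise disjnt v \<and> (\<forall>u\<in>v. \<exists>q. homeomorphism u T (k \<circ> p) q))"
  proof (intro exI conjI)
    show "y \<in> k ` T" using x T by simp
    show "openin (top_of_set S') (k ` T)" by (rule homeomorphism_imp_open_map[OF hom T(2)])
    have "p z \<in> T" if "z \<in> C" "k (p z) \<in> k ` T" for z
      using that k' pC TS by (metis image_eqI image_iff subsetD)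
    then show "\<Union> v = C \<inter> (k \<circ> p) -` (k ` T)" unfolding v(1) by auto
    show "\<forall>u\<in>v. openin (top_of_set C) u" "pairwise disjnt v" by (rule v)+
    have "homeomorphism T (k ` T) k k'"
      using homeomorphism_of_subsets[OF hom TS _ refl] TS kS by blast
    then show "\<forall>u\<in>v. \<exists>q. homeomorphism u (k ` T) (k \<circ> p) q"
      using v(4) homeomorphism_compose by blast
  qed
qed

lemma metric_covering_space_normed:
  fixes p :: "'c::real_normed_vector \<Rightarrow> 'a::metric_space"
  assumes "covering_space C p S"
  obtains k :: "'a \<Rightarrow> 'a \<Rightarrow>\<^sub>C real" where "inj k" "continuous_on UNIV k" "covering_space C (k \<circ> p) (k ` S)"
proof -
  obtain k :: "'a \<Rightarrow> 'a \<Rightarrow>\<^sub>C real" where k: "\<And>x y. dist (k x) (k y) = dist x y"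
    using Kuratowski_embedding by metis
  have inj: "inj k" by (rule injI) (metis k dist_eq_0_iff)
  have cont: "continuous_on A k" for A
    unfolding continuous_on_iff by (auto simp: k)
  have "continuous_on (k ` S) (inv k)"
    unfolding continuous_on_iff using inj by (auto simp flip: k)
  then have "homeomorphism S (k ` S) k (inv k)"
    using inj cont by (intro homeomorphismI) auto
  then show thesis
    using covering_space_homeomorphism_compose[OF assms] inj cont that by blast
qed

lemma covering_space_lift_path_metric:
  fixes p :: "'c::real_normed_vector \<Rightarrow> 'a::metric_space"
  assumes cov: "covering_space C p S" and a: "a \<in> C"
    and g: "path g" "path_image g \<subseteq> S" "pathstart g = p a"
  obtains h where "path h" "path_image h \<subseteq> C" "pathstart h = a" "\<And>t. t \<in> {0..1} \<Longrightarrow> p (h t) = g t"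
proof -
  obtain k :: "'a \<Rightarrow> 'a \<Rightarrow>\<^sub>C real" where k: "inj k" "continuous_on UNIV k"
    "covering_space C (k \<circ> p) (k ` S)"
    using metric_covering_space_normed[OF cov] by blast
  have "path (k \<circ> g)"
    using g(1) k(2) path_continuous_image continuous_on_subset by blast
  moreover have "path_image (k \<circ> g) \<subseteq> k ` S" using g(2) by (auto simp: path_image_def)
  moreover have "pathstart (k \<circ> g) = (k \<circ> p) a" using g(3) by (simp add: pathstart_def)
  ultimately obtain h where h: "path h" "path_image h \<subseteq> C" "pathstart h = a"
    "\<And>t. t \<in> {0..1} \<Longrightarrow> (k \<circ> p) (h t) = (k \<circ> g) t"
    using covering_space_lift_path_strong[OF k(3) a] by blast
  show thesis by (rule that[OF h(1-3)]) (use h(4) k(1) in \<open>simp add: inj_eq\<close>)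
qed

lemma covering_space_lift_strong_metric:
  fixes p :: "'c::real_normed_vector \<Rightarrow> 'a::metric_space" and f :: "'d::real_normed_vector \<Rightarrow> 'a"
  assumes cov: "covering_space C p S" "a \<in> C" "z \<in> U"
    and U: "simply_connected U" "locally path_connected U"
    and f: "continuous_on U f" "f \<in> U \<rightarrow> S" "f z = p a"
  obtains g where "continuous_on U g" "g \<in> U \<rightarrow> C" "g z = a" "\<And>y. y \<in> U \<Longrightarrow> p (g y) = f y"
proof -
  obtain k :: "'a \<Rightarrow> 'a \<Rightarrow>\<^sub>C real" where k: "inj k" "continuous_on UNIV k"
    "covering_space C (k \<circ> p) (k ` S)"
    using metric_covering_space_normed[OF cov(1)] by blast
  have "continuous_on U (k \<circ> f)"
    using f(1) k(2) continuous_on_compose continuous_on_subset by blast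
  moreover have "k \<circ> f \<in> U \<rightarrow> k ` S" using f(2) by auto
  moreover have "(k \<circ> f) z = (k \<circ> p) a" using f(3) by simp
  ultimately obtain g where g: "continuous_on U g" "g \<in> U \<rightarrow> C" "g z = a"
    "\<And>y. y \<in> U \<Longrightarrow> (k \<circ> p) (g y) = (k \<circ> f) y"
    using covering_space_lift_strong[OF k(3) cov(2,3) U] by metis
  show thesis by (rule that[OF g(1-3)]) (use g(4) k(1) in \<open>simp add: inj_eq\<close>)
qed

section \<open>Lifted geodesics and deck transformations\<close>

locale surface_cover =
  fixes F :: "'a::metric_space set" and \<pi> :: "complex \<Rightarrow> 'a"
  assumes surface: "closed_hyperbolic_surface F"
    and cover: "locally_isometric_universal_cover \<pi> F"
begin

lemma covering: "covering_space hplane \<pi> F"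
  using cover by (simp add: locally_isometric_universal_cover_def)

lemma cont: "continuous_on hplane \<pi>"
  by (rule covering_space_imp_continuous[OF covering])

lemma surj: "\<pi> ` hplane = F"
  by (rule covering_space_imp_surjective[OF covering])

lemma isometric_at:
  assumes "x \<in> hplane"
  obtains r where "r > 0" "\<And>a b. a \<in> hball x r \<Longrightarrow> b \<in> hball x r \<Longrightarrow> dist (\<pi> a) (\<pi> b) = hdist a b"
  using cover assms unfolding locally_isometric_universal_cover_def by meson

text \<open>Lift a minimising geodesic from \<open>\<pi> u\<close> to \<open>b\<close>. As \<pi> is
  locally isometric, the lifted path is Lipschitz with the constant of the original, so its endpoint
  is no farther away.\<close>

lemma lift_near:
  assumes u: "u \<in> hplane" and b: "b \<in> F"
  obtains w where "w \<in> hplane" "\<pi> w = b" "hdist u w \<le> dist (\<pi> u) b"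
proof -
  let ?L = "dist (\<pi> u) b"
  obtain c where c: "geodesic_path dist F c (\<pi> u) b"
    using surface surj u b unfolding closed_hyperbolic_surface_def by blast
  then have cF: "c ` {0..?L} \<subseteq> F" and c0: "c 0 = \<pi> u" and cL: "c ?L = b"
    and ciso: "\<And>s t. s \<in> {0..?L} \<Longrightarrow> t \<in> {0..?L} \<Longrightarrow> dist (c s) (c t) = \<bar>s - t\<bar>"
    by (auto simp: geodesic_path_def)
  define g where "g = (\<lambda>t. c (?L * t))"
  have in_range: "?L * t \<in> {0..?L}" if "t \<in> {0..1}" for t
    using that by (auto intro: mult_left_le)
  have gd: "dist (g s) (g t) = ?L * \<bar>s - t\<bar>" if "s \<in> {0..1}" "t \<in> {0..1}" for s t
    using ciso[OF in_range[OF that(1)] in_range[OF that(2)]]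
    by (simp add: g_def abs_mult flip: right_diff_distrib)
  have "?L-lipschitz_on {0..1} g" by (rule lipschitz_onI) (auto simp: gd dist_real_def)
  then have "path g" unfolding path_def by (rule lipschitz_on_continuous_on)
  moreover have "path_image g \<subseteq> F" using cF in_range by (auto simp: path_image_def g_def)
  moreover have "pathstart g = \<pi> u" by (simp add: pathstart_def g_def c0)
  ultimately obtain h where h: "path h" "path_image h \<subseteq> hplane" "pathstart h = u"
    "\<And>t. t \<in> {0..1} \<Longrightarrow> \<pi> (h t) = g t"
    using covering_space_lift_path_metric[OF covering u] by blast
  have hH: "h t \<in> hplane" if "t \<in> {0..1}" for t using h(2) that by (auto simp: path_image_def)
  have "hdist (h 0) (h 1) \<le> ?L * (1 - 0)"
  proof (rule hdist_le_of_locally_Lipschitz)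
    fix t :: real assume t: "t \<in> {0..1}"
    obtain r where r: "r > 0" "\<And>a b. a \<in> hball (h t) r \<Longrightarrow> b \<in> hball (h t) r \<Longrightarrow> dist (\<pi> a) (\<pi> b) = hdist a b"
      using isometric_at[OF hH[OF t]] by blast
    have "continuous_on {0..1} h" using h(1) by (simp add: path_def)
    then have "\<forall>\<^sub>F s in at t within {0..1}. h s \<in> hball (h t) r"
      using t open_hball[OF hH[OF t]] centre_in_hball[OF hH[OF t] r(1)]
      unfolding continuous_on_def by (blast intro: topological_tendstoD)
    then obtain d where d: "d > 0" "\<And>s. s \<in> {0..1} \<Longrightarrow> s \<noteq> t \<Longrightarrow> dist s t < d \<Longrightarrow> h s \<in> hball (h t) r"
      by (auto simp: eventually_at)
    have d': "h s \<in> hball (h t) r" if "s \<in> {0..1}" "\<bar>s - t\<bar> < d" for s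
      using d(2)[OF that(1)] that(2) centre_in_hball[OF hH[OF t] r(1)] by (cases "s = t") (auto simp: dist_real_def)
    have "hdist (h a) (h b) \<le> ?L * (b - a)" if ab: "a \<in> {0..t}" "b \<in> {t..1}" "b - a < d" for a b
    proof -
      have ab01: "a \<in> {0..1}" "b \<in> {0..1}" using ab t by auto
      have "hdist (h a) (h b) = dist (\<pi> (h a)) (\<pi> (h b))"
        using r(2)[of "h a" "h b"] d'[of a] d'[of b] ab ab01 by auto
      also have "\<dots> = ?L * \<bar>a - b\<bar>" using gd h(4) ab01 by simp
      also have "\<dots> = ?L * (b - a)" using ab by simp
      finally show ?thesis by simp
    qed
    then show "\<exists>d>0. \<forall>u\<in>{0..t}. \<forall>v\<in>{t..1}. v - u < d \<longrightarrow> hdist (h u) (h v) \<le> ?L * (v - u)"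
      using d(1) by blast
  qed (use hH in auto)
  then show thesis
    using that[of "h 1"] hH[of 1] h(3) h(4)[of 1] cL by (simp add: pathstart_def g_def)
qed

definition deck :: "(complex \<Rightarrow> complex) \<Rightarrow> bool" where
  "deck g \<longleftrightarrow> g ` hplane = hplane \<and> (\<forall>x\<in>hplane. \<pi> (g x) = \<pi> x) \<and>
     (\<forall>x\<in>hplane. \<forall>y\<in>hplane. hdist (g x) (g y) = hdist x y)"

text \<open>Since \<pi> is isometric near a point and near its image under \<open>g\<close>, the map
  \<open>g\<close> is isometric on small balls; following the geodesic from \<open>x\<close> to
  \<open>y\<close> gives a global bound.\<close>

lemma lift_contracting:
  assumes g: "continuous_on hplane g" "g \<in> hplane \<rightarrow> hplane" "\<And>x. x \<in> hplane \<Longrightarrow> \<pi> (g x) = \<pi> x"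
    and xy: "x \<in> hplane" "y \<in> hplane"
  shows "hdist (g x) (g y) \<le> hdist x y"
proof (cases "x = y")
  case True
  moreover have "g x \<in> hplane" using g(2) xy by auto
  ultimately show ?thesis using xy hdist_eq_0_iff[of x x] hdist_eq_0_iff[of "g x" "g x"] by simp
next
  case False
  define d c where "d = hdist x y" and "c = hseg x y"
  have "geodesic_path hdist hplane c x y" unfolding c_def by (rule geodesic_hseg[OF xy False])
  then have cH: "\<And>t. t \<in> {0..d} \<Longrightarrow> c t \<in> hplane" and c0: "c 0 = x" and cd: "c d = y"
    and ciso: "\<And>s t. s \<in> {0..d} \<Longrightarrow> t \<in> {0..d} \<Longrightarrow> hdist (c s) (c t) = \<bar>s - t\<bar>"
    by (auto simp: geodesic_path_def d_def)
  have d0: "0 \<le> d" using hdist_nonneg[OF xy] by (simp add: d_def)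
  have gH: "g z \<in> hplane" if "z \<in> hplane" for z using g(2) that by auto
  have "hdist (g (c 0)) (g (c d)) \<le> 1 * (d - 0)"
  proof (rule hdist_le_of_locally_Lipschitz[where \<gamma> = "\<lambda>t. g (c t)", OF d0])
    fix t assume t: "t \<in> {0..d}"
    show "g (c t) \<in> hplane" by (intro gH cH t)
    let ?z = "c t"
    obtain r1 where r1: "r1 > 0" "\<And>a b. a \<in> hball ?z r1 \<Longrightarrow> b \<in> hball ?z r1 \<Longrightarrow> dist (\<pi> a) (\<pi> b) = hdist a b"
      using isometric_at[OF cH[OF t]] by blast
    obtain r2 where r2: "r2 > 0" "\<And>a b. a \<in> hball (g ?z) r2 \<Longrightarrow> b \<in> hball (g ?z) r2 \<Longrightarrow> dist (\<pi> a) (\<pi> b) = hdist a b"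
      using isometric_at[OF gH[OF cH[OF t]]] by blast
    \<comment> \<open>Continuity of \<open>g\<close> supplies a ball about \<open>?z\<close> whose
      image stays where \<pi> is isometric near \<open>g ?z\<close>.\<close>
    have "open (hplane \<inter> g -` hball (g ?z) r2)"
      by (rule continuous_open_preimage[OF g(1) open_hplane open_hball[OF gH[OF cH[OF t]]]])
    then obtain r3 where r3: "r3 > 0" "hball ?z r3 \<subseteq> hplane \<inter> g -` hball (g ?z) r2"
      using hball_subset_open[OF _ _ cH[OF t]] centre_in_hball[OF gH[OF cH[OF t]] r2(1)] cH[OF t] by blast
    have "hdist (g (c u)) (g (c v)) \<le> 1 * (v - u)"
      if uv: "u \<in> {0..t}" "v \<in> {t..d}" "v - u < min r1 r3" for u v
    proof -
      have uv': "u \<in> {0..d}" "v \<in> {0..d}" using uv t by auto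
      have "hdist ?z (c u) < min r1 r3" "hdist ?z (c v) < min r1 r3"
        using ciso[OF t uv'(1)] ciso[OF t uv'(2)] uv by auto
      then have b: "c u \<in> hball ?z r1" "c v \<in> hball ?z r1" "c u \<in> hball ?z r3" "c v \<in> hball ?z r3"
        using cH uv' by (auto simp: hball_def)
      have "hdist (g (c u)) (g (c v)) = dist (\<pi> (g (c u))) (\<pi> (g (c v)))"
        using r2(2) b(3,4) r3(2) by (metis IntD2 subsetD vimageD)
      also have "\<dots> = hdist (c u) (c v)" using r1(2)[OF b(1,2)] g(3) cH uv' by simp
      also have "\<dots> = v - u" using ciso[OF uv'] uv by simp
      finally show ?thesis by simp
    qed
    then show "\<exists>d'>0. \<forall>u\<in>{0..t}. \<forall>v\<in>{t..d}. v - u < d' \<longrightarrow> hdist (g (c u)) (g (c v)) \<le> 1 * (v - u)"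
      using r1(1) r3(1) by (intro exI[of _ "min r1 r3"]) auto
  qed
  then show ?thesis unfolding c0 cd by (simp add: d_def)
qed

text \<open>Lift \<pi> through itself in both directions. Uniqueness of lifts makes the two maps
  mutually inverse, and both are contractions, hence isometries.\<close>

lemma deck_exists:
  assumes uw: "u \<in> hplane" "w \<in> hplane" "\<pi> u = \<pi> w"
  obtains g where "deck g" "g u = w"
proof -
  have U: "simply_connected hplane" "locally path_connected hplane" "connected hplane"
    by (auto simp: convex_hplane convex_imp_simply_connected convex_imp_locally_path_connected convex_connected)
  have \<pi>F: "\<pi> \<in> hplane \<rightarrow> F" using surj by auto
  obtain g where g: "continuous_on hplane g" "g \<in> hplane \<rightarrow> hplane" "g u = w"
      "\<And>x. x \<in> hplane \<Longrightarrow> \<pi> (g x) = \<pi> x"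
    using covering_space_lift_strong_metric[OF covering uw(2,1) U(1,2) cont \<pi>F uw(3)] by metis
  obtain g' where g': "continuous_on hplane g'" "g' \<in> hplane \<rightarrow> hplane" "g' w = u"
      "\<And>x. x \<in> hplane \<Longrightarrow> \<pi> (g' x) = \<pi> x"
    using covering_space_lift_strong_metric[OF covering uw(1,2) U(1,2) cont \<pi>F uw(3)[symmetric]] by metis
  have inv: "f' (f x) = x"
    if f: "continuous_on hplane f" "f \<in> hplane \<rightarrow> hplane" "\<And>x. x \<in> hplane \<Longrightarrow> \<pi> (f x) = \<pi> x"
      and f': "continuous_on hplane f'" "f' \<in> hplane \<rightarrow> hplane" "\<And>x. x \<in> hplane \<Longrightarrow> \<pi> (f' x) = \<pi> x"
      and z: "z \<in> hplane" "f' (f z) = z" and x: "x \<in> hplane" for f f' z x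
  proof (rule covering_space_lift_unique[OF covering, of "\<lambda>x. f' (f x)" z "\<lambda>x. x" hplane \<pi>])
    show "continuous_on hplane (\<lambda>x. f' (f x))"
      by (rule continuous_on_compose2[OF f'(1) f(1)]) (use f(2) in auto)
    show "\<pi> x = \<pi> (f' (f x))" if "x \<in> hplane" for x
      using f(2,3) f'(3) that by (metis PiE)
  qed (use f f' z x cont \<pi>F U in \<open>auto intro: continuous_on_id\<close>)
  have gg': "g' (g x) = x" "g (g' x) = x" if "x \<in> hplane" for x
    using inv[OF g(1,2,4) g'(1,2,4) uw(1) _ that] inv[OF g'(1,2,4) g(1,2,4) uw(2) _ that] g(3) g'(3)
    by simp_all
  have "deck g"
    unfolding deck_def
  proof (intro conjI ballI)
    have "x \<in> g ` hplane" if "x \<in> hplane" for x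
      using gg'(2)[OF that] g'(2) that by (metis PiE image_eqI)
    then show "g ` hplane = hplane" using g(2) by auto
    show "\<pi> (g x) = \<pi> x" if "x \<in> hplane" for x by (rule g(4)[OF that])
    show "hdist (g x) (g y) = hdist x y" if xy: "x \<in> hplane" "y \<in> hplane" for x y
    proof (rule antisym)
      show "hdist (g x) (g y) \<le> hdist x y" by (rule lift_contracting[OF g(1,2,4) xy])
      have "g x \<in> hplane" "g y \<in> hplane" using g(2) xy by auto
      from lift_contracting[OF g'(1,2,4) this] show "hdist x y \<le> hdist (g x) (g y)"
        using gg' xy by simp
    qed
  qed
  then show thesis using that g(3) by blast
qed

end

section \<open>The centered dual graph of a closed surface\<close>

locale voronoi_surface = surface_cover F \<pi> for F :: "'a::metric_space set" and \<pi> +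
  fixes S :: "'a set"
  assumes S: "S \<subseteq> F" "finite S" "S \<noteq> {}"
begin

abbreviation T :: "complex set" where "T \<equiv> lifts \<pi> S"

abbreviation G :: "'a set" where "G \<equiv> F - centered_dual_graph \<pi> S"

lemma compact_F: "compact F"
  using surface by (simp add: closed_hyperbolic_surface_def)

text \<open>At an accumulation point, a ball on which \<pi> is injective would contain infinitely
  many lifts of the finite set \<open>S\<close>.\<close>

lemma finite_lifts_cball:
  assumes "r < 1"
  shows "finite (T \<inter> cball 0 r)"
proof (rule ccontr)
  assume inf: "infinite (T \<inter> cball 0 r)"
  obtain x where x: "x \<in> cball 0 r" "x islimpt (T \<inter> cball 0 r)"
    using Heine_Borel_imp_Bolzano_Weierstrass[OF compact_cball inf Int_lower2] by blast
  have xH: "x \<in> hplane" using x(1) assms by (simp add: hplane_iff)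
  obtain e where e: "e > 0" "\<And>a b. a \<in> hball x e \<Longrightarrow> b \<in> hball x e \<Longrightarrow> dist (\<pi> a) (\<pi> b) = hdist a b"
    using isometric_at[OF xH] by blast
  let ?X = "hball x e \<inter> (T \<inter> cball 0 r)"
  have "infinite ?X"
    using x(2) open_hball[OF xH] centre_in_hball[OF xH e(1)] unfolding islimpt_eq_acc_point by blast
  moreover have "inj_on \<pi> ?X"
  proof (rule inj_onI)
    fix a b assume ab: "a \<in> ?X" "b \<in> ?X" "\<pi> a = \<pi> b"
    then have "hdist a b = 0" using e(2)[of a b] by simp
    then show "a = b" using ab hdist_eq_0_iff[of a b] by (auto simp: hball_def)
  qed
  moreover have "finite (\<pi> ` ?X)"
    by (rule finite_subset[OF _ S(2)]) (auto simp: lifts_def)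
  ultimately show False using finite_imageD by blast
qed

sublocale net T "diameter F"
proof
  show "T \<subseteq> hplane" by (auto simp: lifts_def)
  show "finite (T \<inter> cball 0 r)" if "r < 1" for r by (rule finite_lifts_cball[OF that])
  show "\<exists>x\<in>T. hdist v x \<le> diameter F" if v: "v \<in> hplane" for v
  proof -
    obtain s where s: "s \<in> S" using S(3) by blast
    then obtain w where w: "w \<in> hplane" "\<pi> w = s" "hdist v w \<le> dist (\<pi> v) s"
      using lift_near[OF v, of s] S(1) by blast
    have "dist (\<pi> v) s \<le> diameter F"
      using diameter_bounded_bound[OF compact_imp_bounded[OF compact_F]] surj v s S(1) by blast
    then show ?thesis using w s by (intro bexI[of _ w]) (auto simp: lifts_def)
  qed
qed

section \<open>Equivariance of the tessellation under deck transformations\<close>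

lemma deck_lifts:
  assumes "deck g"
  shows "g ` T = T"
proof
  have g: "g x \<in> hplane" "\<pi> (g x) = \<pi> x" if "x \<in> hplane" for x
    using assms that by (auto simp: deck_def)
  then show "g ` T \<subseteq> T" by (auto simp: lifts_def)
  show "T \<subseteq> g ` T"
  proof
    fix y assume y: "y \<in> T"
    then have "y \<in> g ` hplane" using assms by (simp add: deck_def lifts_def)
    then obtain x where "x \<in> hplane" "y = g x" by blast
    then show "y \<in> g ` T" using y g by (auto simp: lifts_def)
  qed
qed

lemma deck_eq_iff:
  assumes "deck g" "x \<in> hplane" "y \<in> hplane"
  shows "g x = g y \<longleftrightarrow> x = y"
proof -
  have "g x \<in> hplane" "g y \<in> hplane" "hdist (g x) (g y) = hdist x y"
    using assms by (auto simp: deck_def)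
  then show ?thesis using hdist_eq_0_iff[OF assms(2,3)] hdist_eq_0_iff[of "g x" "g y"] by auto
qed

lemma deck_vertex:
  assumes g: "deck g" and v: "v \<in> voronoi_vertices T"
  shows "g v \<in> voronoi_vertices T"
proof -
  have vH: "v \<in> hplane" using v by (simp add: voronoi_vertices_iff)
  have iso: "hdist (g x) (g y) = hdist x y" if "x \<in> hplane" "y \<in> hplane" for x y
    using g that by (simp add: deck_def)
  have site: "g a \<in> sites_at T (g v)" if a: "a \<in> sites_at T v" for a
  proof -
    have aT: "a \<in> T" using a by (simp add: sites_at_def)
    have "hdist (g v) (g a) \<le> hdist (g v) y" if "y \<in> T" for y
    proof -
      have "y \<in> g ` T" using that by (simp only: deck_lifts[OF g])
      then obtain z where z: "z \<in> T" "y = g z" by blast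
      then have "hdist v a \<le> hdist v z" using a by (simp add: sites_at_def)
      then show ?thesis
        unfolding z(2) iso[OF vH in_hplane[OF aT]] iso[OF vH in_hplane[OF z(1)]] .
    qed
    moreover have "g a \<in> T" using deck_lifts[OF g] aT by blast
    ultimately show ?thesis by (simp add: sites_at_def)
  qed
  obtain x y z where xyz: "x \<noteq> y" "y \<noteq> z" "x \<noteq> z" "{x, y, z} \<subseteq> sites_at T v"
    using v by (auto simp: voronoi_vertices_iff)
  have H: "x \<in> hplane" "y \<in> hplane" "z \<in> hplane"
    using xyz(4) in_hplane by (auto simp: sites_at_def)
  have "g x \<noteq> g y" "g y \<noteq> g z" "g x \<noteq> g z" "{g x, g y, g z} \<subseteq> sites_at T (g v)"
    using xyz site deck_eq_iff[OF g] H by auto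
  moreover have "g v \<in> hplane" using g vH by (auto simp: deck_def)
  ultimately show ?thesis unfolding voronoi_vertices_iff by blast
qed

lemma deck_centered_pair:
  assumes g: "deck g" and xy: "centered_pair T x y"
  shows "centered_pair T (g x) (g y)"
proof -
  have iso: "hdist (g x) (g y) = hdist x y" if "x \<in> hplane" "y \<in> hplane" for x y
    using g that by (simp add: deck_def)
  have T: "x \<in> T" "y \<in> T" "x \<noteq> y" using xy by (auto simp: centered_pair_def)
  note H = in_hplane[OF T(1)] in_hplane[OF T(2)]
  obtain m where m: "m \<in> hplane" "hdist x m + hdist m y = hdist x y" "hdist m x = hdist m y"
      "\<And>z. z \<in> T - {x, y} \<Longrightarrow> hdist m x < hdist m z"
    using xy by (auto simp: centered_pair_def)
  have "hdist (g m) (g x) < hdist (g m) z" if z: "z \<in> T - {g x, g y}" for z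
  proof -
    have "z \<in> g ` T" using z by (simp only: deck_lifts[OF g] Diff_iff)
    then obtain w where w: "w \<in> T" "z = g w" by blast
    then have "hdist m x < hdist m w" using z by (intro m(4)) auto
    then show ?thesis
      unfolding w(2) iso[OF m(1) H(1)] iso[OF m(1) in_hplane[OF w(1)]] .
  qed
  moreover have "g m \<in> hplane" "g x \<in> T" "g y \<in> T" "g x \<noteq> g y"
    using g m(1) deck_lifts[OF g] T deck_eq_iff[OF g H] by (auto simp: deck_def)
  moreover have "hdist (g x) (g m) + hdist (g m) (g y) = hdist (g x) (g y)" "hdist (g m) (g x) = hdist (g m) (g y)"
    using iso m H by auto
  ultimately show ?thesis unfolding centered_pair_def by blast
qed

text \<open>The dual through \<open>\<pi> u\<close> may be given by an arc through another lift of
  this point; a deck transformation moves that arc onto \<open>u\<close>.\<close>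

lemma centered_dual_graph_lift:
  assumes u: "u \<in> hplane" "\<pi> u \<in> centered_dual_graph \<pi> S"
  obtains x y where "centered_pair T x y" "u \<in> closed_segment x y"
proof -
  obtain x y z where c: "centered_edge T x y" and z: "z \<in> geodesic_arc x y" "\<pi> u = \<pi> z"
    using u(2) by (auto simp: centered_dual_graph_def)
  have xy: "centered_pair T x y" by (rule centered_edge_imp_pair[OF sub_hplane c])
  then have H: "x \<in> hplane" "y \<in> hplane" using in_hplane by (auto simp: centered_pair_def)
  have zH: "z \<in> hplane" "hdist x z + hdist z y = hdist x y"
    using z(1) geodesic_arc_eq_segment[OF H] closed_segment_iff_hdist[OF H] by auto
  obtain g where g: "deck g" "g z = u" using deck_exists[OF zH(1) u(1) z(2)[symmetric]] by blast
  have "g x \<in> hplane" "g y \<in> hplane" "hdist (g x) u + hdist u (g y) = hdist (g x) (g y)"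
    using g H zH by (auto simp: deck_def)
  then have "u \<in> closed_segment (g x) (g y)" using closed_segment_iff_hdist u(1) by blast
  then show thesis using that deck_centered_pair[OF g(1) xy] by blast
qed

section \<open>Spokes and components of the complement\<close>

lemma spoke_in_complement:
  assumes v: "v \<in> voronoi_vertices T" and p: "p \<in> vertex_polygon T v"
    and q: "q \<in> closed_segment v p" "q \<noteq> p"
  shows "q \<in> hplane" "\<pi> q \<in> G"
proof -
  have vH: "v \<in> hplane" using v by (simp add: voronoi_vertices_iff)
  have p': "p \<in> convex hull (sites_at T v)" using p vertex_polygon_eq[OF sub_hplane vH] by simp
  obtain a where "a \<in> sites_at T v" using v by (auto simp: voronoi_vertices_iff)
  then have "p \<in> hplane" using vertex_polygon_radius(1)[OF sub_hplane vH _ p'] by blast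
  then show qH: "q \<in> hplane" using q(1) vH closed_segment_iff_hdist by blast
  have "\<pi> q \<notin> centered_dual_graph \<pi> S"
    using centered_dual_graph_lift[OF qH] centered_pair_misses_spoke[OF sub_hplane v p' q] by blast
  then show "\<pi> q \<in> G" using surj qH by blast
qed

lemma spoke_in_component:
  assumes U: "U \<in> components G" and vH: "v \<in> hplane"
    and seg: "\<And>q. q \<in> closed_segment v p \<Longrightarrow> q \<in> hplane \<and> \<pi> q \<in> G"
    and meets: "\<exists>q \<in> closed_segment v p. \<pi> q \<in> U"
  shows "\<pi> ` closed_segment v p \<subseteq> U"
proof (rule components_maximal[OF U])
  show "connected (\<pi> ` closed_segment v p)"
    using cont seg by (intro connected_continuous_image connected_segment) (auto elim: continuous_on_subset)
qed (use seg meets in auto)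

text \<open>\<open>v\<close> is the starting point of the spoke towards a site other than
  \<open>v\<close>, hence not the end that the spoke lemma excludes.\<close>

lemma vertex_in_complement:
  assumes v: "v \<in> voronoi_vertices T"
  shows "\<pi> v \<in> G"
proof -
  have vH: "v \<in> hplane" using v by (simp add: voronoi_vertices_iff)
  obtain x y where "x \<noteq> y" "{x, y} \<subseteq> sites_at T v" using v by (auto simp: voronoi_vertices_iff)
  then obtain a where a: "a \<in> sites_at T v" "v \<noteq> a" by auto
  then have "a \<in> vertex_polygon T v"
    using vertex_polygon_eq[OF sub_hplane vH] hull_inc by metis
  then show ?thesis using spoke_in_complement(2)[OF v _ _ a(2)] by simp
qed

lemma polygon_in_closure:
  assumes U: "U \<in> components G" and v: "v \<in> voronoi_vertices T" "\<pi> v \<in> U"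
    and p: "p \<in> vertex_polygon T v"
  shows "\<pi> p \<in> closure U"
proof (cases "p = v")
  case True
  then show ?thesis using v(2) closure_subset by blast
next
  case False
  have vH: "v \<in> hplane" using v(1) by (simp add: voronoi_vertices_iff)
  have "v \<in> closed_segment v p" by simp
  \<comment> \<open>\<open>p\<close> itself may lie on the graph, so it is approached along the
    spoke; the sequence starts at \<open>q 0 = v\<close>.\<close>
  define q where "q = (\<lambda>n. p + inverse (real (Suc n)) *\<^sub>R (v - p))"
  have q_seg: "q n \<in> closed_segment v p" for n
    unfolding in_segment q_def
    by (intro exI[of _ "1 - inverse (real (Suc n))"]) (simp add: algebra_simps inverse_le_1_iff)
  have q_ne: "q n \<noteq> p" for n using False by (simp add: q_def)
  have qU: "\<pi> (q n) \<in> U" for n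
  proof -
    have "w \<in> hplane \<and> \<pi> w \<in> G" if w: "w \<in> closed_segment v (q n)" for w
    proof -
      have "w \<in> closed_segment v p"
        using w q_seg[of n] by (meson closed_segment_subset convex_closed_segment ends_in_segment(1) subsetD)
      moreover have "w \<noteq> p"
      proof
        assume "w = p"
        then have "p \<in> closed_segment v (q n)" using w by simp
        moreover have "q n \<in> closed_segment v p" by (rule q_seg)
        ultimately have "dist v p \<le> dist v (q n)" "dist v (q n) + dist (q n) p = dist v p"
          using dist_in_closed_segment[of p v "q n"] between_mem_segment[of v p "q n"]
          by (auto simp: between dist_commute)
        then have "dist (q n) p \<le> 0" by linarith
        then show False using q_ne[of n] by simp
      qed
      ultimately show ?thesis using spoke_in_complement[OF v(1) p] by blast
    qed
    then have "\<pi> ` closed_segment v (q n) \<subseteq> U"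
      using v(2) by (intro spoke_in_component[OF U vH]) auto
    then show ?thesis by auto
  qed
  have "(\<lambda>n. p + inverse (real (Suc n)) *\<^sub>R (v - p)) \<longlonglongrightarrow> p + 0 *\<^sub>R (v - p)"
    by (intro tendsto_intros LIMSEQ_inverse_real_of_nat)
  then have "q \<longlonglongrightarrow> p" by (simp add: q_def)
  moreover have "p \<in> hplane"
    using p vH vertex_polygon_eq[OF sub_hplane vH] v(1) vertex_polygon_radius(1)[OF sub_hplane vH]
    by (auto simp: voronoi_vertices_iff)
  moreover have "\<forall>\<^sub>F n in sequentially. q n \<in> hplane"
    using spoke_in_complement(1)[OF v(1) p q_seg q_ne] by simp
  ultimately have "(\<lambda>n. \<pi> (q n)) \<longlonglongrightarrow> \<pi> p"
    by (rule continuous_on_tendsto_compose[OF cont])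
  then show ?thesis
    unfolding closure_sequential using qU by (intro exI[of _ "\<lambda>n. \<pi> (q n)"]) simp
qed

lemma vertex_of_component:
  assumes U: "U \<in> components G" and p: "p \<in> hplane" "\<pi> p \<in> U"
  obtains v where "v \<in> voronoi_vertices T" "p \<in> vertex_polygon T v" "\<pi> v \<in> U"
proof -
  obtain v where v: "v \<in> voronoi_vertices T" "p \<in> vertex_polygon T v"
    using vertex_polygons_cover[OF p(1)] by blast
  have vH: "v \<in> hplane" using v(1) by (simp add: voronoi_vertices_iff)
  have "\<pi> p \<in> G" using p(2) U in_components_subset by blast
  then have "q \<in> hplane \<and> \<pi> q \<in> G" if "q \<in> closed_segment v p" for q
    using spoke_in_complement[OF v that] p(1) by (cases "q = p") auto
  then have "\<pi> ` closed_segment v p \<subseteq> U"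
    using p(2) by (intro spoke_in_component[OF U vH]) auto
  then show thesis using that v by auto
qed

lemma polygon_of_closure:
  assumes U: "U \<in> components G" and u: "u \<in> closure U"
  obtains v p where "v \<in> voronoi_vertices T" "\<pi> v \<in> U" "p \<in> vertex_polygon T v" "\<pi> p = u"
proof -
  have UF: "U \<subseteq> F" using in_components_subset[OF U] by blast
  have "u \<in> F" using u closure_minimal[OF UF compact_imp_closed[OF compact_F]] by blast
  then obtain p where p: "p \<in> hplane" "\<pi> p = u" using surj by blast
  \<comment> \<open>The point \<open>q\<close> found below is within 1 of \<open>p\<close>, its
    vertex \<open>v\<close> within \<open>diameter F\<close> of \<open>q\<close>, and the sites at
    \<open>v\<close> within \<open>diameter F\<close> of \<open>v\<close>.\<close>
  define N where "N = {x \<in> T. hdist p x \<le> 1 + diameter F + diameter F}"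
  \<comment> \<open>Collecting site sets instead of vertices makes finiteness immediate from that of
    \<open>N\<close>; finitely many compact hulls have a closed union.\<close>
  define \<A> where "\<A> = {sites_at T v | v. v \<in> voronoi_vertices T \<and> \<pi> v \<in> U \<and> sites_at T v \<subseteq> N}"
  have finN: "finite N" unfolding N_def by (rule finite_near[OF p(1)])
  have "\<A> \<subseteq> Pow N" by (auto simp: \<A>_def)
  then have fin\<A>: "finite \<A>" using finN finite_subset by blast
  define W where "W = (\<Union>A\<in>\<A>. convex hull A)"
  have "compact (convex hull A)" if "A \<in> \<A>" for A
    using that finN finite_subset by (intro finite_imp_compact_convex_hull) (auto simp: \<A>_def)
  then have W: "closed W"
    unfolding W_def using fin\<A> by (intro closed_UN) (auto intro: compact_imp_closed)
  have "p \<in> W"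
  proof (rule ccontr)
    assume "p \<notin> W"
    let ?O = "hball p 1 \<inter> - W"
    have O: "open ?O" using open_hball[OF p(1)] W by auto
    have OH: "?O \<subseteq> hplane" by (auto simp: hball_def)
    \<comment> \<open>Covering maps are open, so the part of the ball outside \<open>W\<close>
      projects to a neighbourhood of \<open>u\<close> in \<open>F\<close>, which must meet
      \<open>U\<close>.\<close>
    have "openin (top_of_set F) (\<pi> ` ?O)"
      using O OH by (intro covering_space_open_map[OF covering] open_subset)
    then obtain Q where Q: "open Q" "\<pi> ` ?O = F \<inter> Q" by (auto simp: openin_open)
    have "p \<in> ?O" using centre_in_hball[OF p(1)] \<open>p \<notin> W\<close> by simp
    then have "\<pi> p \<in> F \<inter> Q" unfolding Q(2)[symmetric] by (rule imageI)
    then have "Q \<inter> closure U \<noteq> {}" using u p(2) by auto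
    then obtain u' where u': "u' \<in> U" "u' \<in> Q" using open_Int_closure_eq_empty[OF Q(1)] by blast
    then have "u' \<in> \<pi> ` ?O" unfolding Q(2) using UF by auto
    then obtain q where q: "q \<in> ?O" "\<pi> q = u'" by blast
    then have qH: "q \<in> hplane" and qU: "\<pi> q \<in> U" using OH u' by auto
    obtain v where v: "v \<in> voronoi_vertices T" "q \<in> vertex_polygon T v" "\<pi> v \<in> U"
      using vertex_of_component[OF U qH qU] by blast
    have vH: "v \<in> hplane" using v(1) by (simp add: voronoi_vertices_iff)
    have q': "q \<in> convex hull (sites_at T v)" using v(2) vertex_polygon_eq[OF sub_hplane vH] by simp
    have "hdist p a \<le> 1 + diameter F + diameter F" if a: "a \<in> sites_at T v" for a
    proof -
      have aH: "a \<in> hplane" using a in_hplane by (auto simp: sites_at_def)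
      have "hdist p a \<le> hdist p q + hdist q a" by (rule hdist_triangle[OF p(1) qH aH])
      also have "hdist q a \<le> hdist q v + hdist v a" by (rule hdist_triangle[OF qH vH aH])
      also have "hdist v a \<le> diameter F" by (rule sites_at_near[OF vH a])
      also have "hdist q v \<le> diameter F"
        using vertex_polygon_radius(2)[OF sub_hplane vH a q'] sites_at_near[OF vH a]
        by (simp add: hdist_commute[of q v])
      also have "hdist p q \<le> 1" using q(1) by (simp add: hball_def)
      finally show ?thesis by simp
    qed
    then have "sites_at T v \<subseteq> N" by (auto simp: N_def sites_at_def)
    then have "sites_at T v \<in> \<A>" using v by (auto simp: \<A>_def)
    then have "q \<in> W" using q' by (auto simp: W_def)
    then show False using q(1) by simp
  qed
  then obtain v where v: "v \<in> voronoi_vertices T" "\<pi> v \<in> U" "p \<in> convex hull (sites_at T v)"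
    by (auto simp: W_def \<A>_def)
  have "v \<in> hplane" using v(1) by (simp add: voronoi_vertices_iff)
  then have "p \<in> vertex_polygon T v" using v(3) vertex_polygon_eq[OF sub_hplane] by simp
  then show thesis using that v(1,2) p(2) by blast
qed

lemma closure_component_inter:
  assumes "U \<in> components G"
  shows "closure U \<inter> G \<subseteq> U"
proof -
  obtain C where C: "closed C" "U = G \<inter> C"
    using closedin_component[OF assms] by (auto simp: closedin_closed)
  then have "closure U \<subseteq> C" by (intro closure_minimal) auto
  then show ?thesis using C(2) by blast
qed

theorem closure_component_eq:
  assumes U: "U \<in> components G"
  shows "closure U = (\<Union>v \<in> closure U \<inter> surface_voronoi_vertices \<pi> S. surface_vertex_polygon \<pi> S v)"
proof (intro equalityI subsetI)
  fix u assume "u \<in> closure U"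
  then obtain v p where v: "v \<in> voronoi_vertices T" "\<pi> v \<in> U" "p \<in> vertex_polygon T v" "\<pi> p = u"
    using polygon_of_closure[OF U] by blast
  have "v \<in> lifts \<pi> {\<pi> v}" using v(1) by (simp add: lifts_def voronoi_vertices_iff)
  then have "u \<in> surface_vertex_polygon \<pi> S (\<pi> v)"
    using v(3,4) by (auto simp: surface_vertex_polygon_def)
  moreover have "\<pi> v \<in> closure U \<inter> surface_voronoi_vertices \<pi> S"
    using v(1,2) closure_subset by (auto simp: surface_voronoi_vertices_def)
  ultimately show "u \<in> (\<Union>v \<in> closure U \<inter> surface_voronoi_vertices \<pi> S. surface_vertex_polygon \<pi> S v)"
    by blast
next
  fix u assume "u \<in> (\<Union>v \<in> closure U \<inter> surface_voronoi_vertices \<pi> S. surface_vertex_polygon \<pi> S v)"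
  then obtain v' w p where v': "v' \<in> voronoi_vertices T" "\<pi> v' \<in> closure U"
    and w: "w \<in> hplane" "\<pi> w = \<pi> v'" and p: "p \<in> vertex_polygon T w" "u = \<pi> p"
    by (auto simp: surface_voronoi_vertices_def surface_vertex_polygon_def lifts_def)
  \<comment> \<open>The polygon is taken at an arbitrary lift \<open>w\<close> of the vertex; a deck
    transformation shows that \<open>w\<close> is again a vertex. As vertices avoid the graph and
    components are relatively closed, \<open>\<pi> w\<close> is in \<open>U\<close> itself.\<close>
  have "v' \<in> hplane" using v'(1) by (simp add: voronoi_vertices_iff)
  then obtain g where "deck g" "g v' = w" using deck_exists w by metis
  then have wV: "w \<in> voronoi_vertices T" using deck_vertex v'(1) by blast
  then have "\<pi> w \<in> U"
    using closure_component_inter[OF U] vertex_in_complement v'(2) w(2) by fastforce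
  then show "u \<in> closure U" using polygon_in_closure[OF U wV _ p(1)] p(2) by simp
qed

end

theorem proposition3p16:
  fixes F S U :: "'a::metric_space set" and \<pi> :: "complex \<Rightarrow> 'a"
  assumes "closed_hyperbolic_surface F"
    and "locally_isometric_universal_cover \<pi> F"
    and "S \<subseteq> F" and "finite S" and "S \<noteq> {}"
    and "U \<in> components (F - centered_dual_graph \<pi> S)"
  shows "closure U =
    (\<Union>v \<in> closure U \<inter> surface_voronoi_vertices \<pi> S. surface_vertex_polygon \<pi> S v)"
proof -
  interpret voronoi_surface F \<pi> S
    using assms by unfold_locales
  show ?thesis by (rule closure_component_eq[OF assms(6)])
qed

end
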